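(* Let $G$ be a connected solvable Lie group with Lie algebra $\mathfrak g$, and let $\mathcal X$ be a hyperbolic linear vector field on $G$ with hyperbolic decomposition $\mathfrak g=\mathfrak g^+\oplus\mathfrak g^-$ and $G=G^+G^-=G^-G^+$. Let $\Sigma$ be the linear control system on $G$ $$\dot g=\mathcal X(g)+\sum_{\alpha=1}^{m_+}u^+_\alpha X^+_\alpha(g)+\sum_{\beta=1}^{m_-}u^-_\beta X^-_\beta(g),$$ where $X^+_\alpha,X^-_\beta$ are right-invariant vector fields with $X^+_\alpha(e)\in\mathfrak g^+$ and $X^-_\beta(e)\in\mathfrak g^-$, and where the admissible controls split independently. Let $\Sigma^+$ and $\Sigma^-$ be the induced systems on $G^+$ and $G^-$. If $\Sigma^+$ is controllable on $G^+$ and $\Sigma^-$ is controllable on $G^-$, then $\Sigma$ is controllable on $G$.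
   Context: A vector field $\mathcal X$ on a connected Lie group $G$ (identity $e$) is linear if its flow $(\varphi_t)_{t\in\mathbb R}$ is a one-parameter subgroup of $\operatorname{Aut}(G)$. Its associated derivation $\mathcal D$ of $\mathfrak g$ is $\mathcal D(Y)=-[\mathcal X,Y]$; equivalently $(d\varphi_t)_e=e^{t\mathcal D}$, so $\varphi_t(\exp Y)=\exp(e^{t\mathcal D}Y)$. $\mathcal X$ is hyperbolic if $\mathcal D$ has no eigenvalue with zero real part. $\mathfrak g^+$ (resp. $\mathfrak g^-$) is the sum of the (real) generalized eigenspaces of $\mathcal D$ for eigenvalues with positive (resp. negative) real part; these are $\mathcal D$-invariant Lie subalgebras, and $G^\pm$ are the corresponding connected Lie subgroups of $G$. They are invariant under $\varphi_t$; $\mathcal X^\pm$ denotes the linear vector field on $G^\pm$ with flow $\varphi^\pm_t=\varphi_t|_{G^\pm}$. Standing assumption: $\mathfrak g=\mathfrak g^+\oplus\mathfrak g^-$ and $G=G^+G^-=G^-G^+$. The induced systems are $\Sigma^+:\ \dot g=\mathcal X^+(g)+\sum_{\alpha=1}^{m_+}u^+_\alpha X^+_\alpha(g)$ on $G^+$ and $\Sigma^-:\ \dot g=\mathcal X^-(g)+\sum_{\beta=1}^{m_-}u^-_\beta X^-_\beta(g)$ on $G^-$. Admissible controls are measurable, locally bounded functions of time belonging to classes that contain the zero control and are closed under time shifts and concatenation. The admissible controls split independently: whenever $u^+$ is admissible for $\Sigma^+$ and $u^-$ is admissible for $\Sigma^-$, the controls $(u^+,0)$, $(0,u^-)$ and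 $(u^+,u^-)$ are admissible for $\Sigma$. A system is controllable on its state space if for any two points $g,h$ there are a time $t\ge 0$ and an admissible control whose trajectory starting at $g$ is at $h$ at time $t$. *)

theory Defs
  imports "HOL-Analysis.Analysis" "HOL-Algebra.Solvable_Groups"
begin

section \<open>Smooth maps between normed spaces\<close>

text \<open>\<open>Ck_on k S f\<close> says that \<open>f\<close> is \<open>k\<close> times continuously differentiable on \<open>S\<close>.
  It is only meaningful, and only used, for open \<open>S\<close> in a finite-dimensional space.\<close>

primrec Ck_on :: "nat \<Rightarrow> 'e set \<Rightarrow> ('e::real_normed_vector \<Rightarrow> 'f::real_normed_vector) \<Rightarrow> bool" where
  "Ck_on 0 S f \<longleftrightarrow> continuous_on S f"
| "Ck_on (Suc k) S f \<longleftrightarrow>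
     (\<forall>x\<in>S. f differentiable (at x)) \<and> (\<forall>v. Ck_on k S (\<lambda>x. frechet_derivative f (at x) v))"

definition smooth_on :: "'e set \<Rightarrow> ('e::real_normed_vector \<Rightarrow> 'f::real_normed_vector) \<Rightarrow> bool" where
  "smooth_on S f \<longleftrightarrow> (\<forall>k. Ck_on k S f)"


section \<open>Smooth manifolds\<close>

type_synonym ('a, 'e) chart = "'a set \<times> ('a \<Rightarrow> 'e)"

record ('a, 'e) smooth_mfd =
  mtop :: "'a topology"
  atlas :: "('a, 'e) chart set"

text \<open>The model space is a Euclidean space, i.e. an inner product space with a finite
  orthonormal basis \<open>B\<close>. The class \<open>euclidean_space\<close> is not used because it forces dimension at
  least one, while zero-dimensional manifolds are needed (either of the two subgroups below may
  be trivial).\<close>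

definition manifold :: "('a, 'e::real_inner) smooth_mfd \<Rightarrow> bool" where
  "manifold M \<longleftrightarrow>
     (\<exists>B::'e set. finite B \<and> pairwise orthogonal B \<and> (\<forall>b\<in>B. norm b = 1) \<and> span B = UNIV) \<and>
     Hausdorff_space (mtop M) \<and> second_countable (mtop M) \<and>
     \<Union> (fst ` atlas M) = topspace (mtop M) \<and>
     (\<forall>(U, x) \<in> atlas M. openin (mtop M) U \<and> open (x ` U) \<and>
        homeomorphic_map (subtopology (mtop M) U) (top_of_set (x ` U)) x) \<and>
     (\<forall>(U, x) \<in> atlas M. \<forall>(V, y) \<in> atlas M. smooth_on (x ` (U \<inter> V)) (y \<circ> inv_into U x))"

definition prod_mfd :: "('a, 'e) smooth_mfd \<Rightarrow> ('b, 'f) smooth_mfd \<Rightarrow> ('a \<times> 'b, 'e \<times> 'f) smooth_mfd" where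
  "prod_mfd M N = \<lparr> mtop = prod_topology (mtop M) (mtop N),
     atlas = {(U \<times> V, map_prod x y) | U x V y. (U, x) \<in> atlas M \<and> (V, y) \<in> atlas N} \<rparr>"

definition smooth_map ::
  "('a, 'e::real_inner) smooth_mfd \<Rightarrow> ('b, 'f::real_inner) smooth_mfd \<Rightarrow> ('a \<Rightarrow> 'b) \<Rightarrow> bool" where
  "smooth_map M N f \<longleftrightarrow> continuous_map (mtop M) (mtop N) f \<and>
     (\<forall>(U, x) \<in> atlas M. \<forall>(V, y) \<in> atlas N.
        smooth_on (x ` {p \<in> U. f p \<in> V}) (y \<circ> f \<circ> inv_into U x))"

text \<open>At every point \<open>p\<close> one chart is selected once and for all. A tangent vector at \<open>p\<close> is
  given by its coordinates in that chart, so that each tangent space is a copy of the model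
  space and a vector field is a function from points to the model space.\<close>

definition pchart :: "('a, 'e) smooth_mfd \<Rightarrow> 'a \<Rightarrow> ('a, 'e) chart" where
  "pchart M p = (SOME c. c \<in> atlas M \<and> p \<in> fst c)"

definition coord :: "('a, 'e) smooth_mfd \<Rightarrow> 'a \<Rightarrow> 'a \<Rightarrow> 'e" where
  "coord M p = snd (pchart M p)"

definition uncoord :: "('a, 'e) smooth_mfd \<Rightarrow> 'a \<Rightarrow> 'e \<Rightarrow> 'a" where
  "uncoord M p = inv_into (fst (pchart M p)) (snd (pchart M p))"

text \<open>The differential of \<open>f : M \<rightarrow> N\<close> at \<open>p\<close>.\<close>

definition mdiff ::
  "('a, 'e::real_inner) smooth_mfd \<Rightarrow> ('b, 'f::real_inner) smooth_mfd \<Rightarrow>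
   ('a \<Rightarrow> 'b) \<Rightarrow> 'a \<Rightarrow> 'e \<Rightarrow> 'f" where
  "mdiff M N f p =
     frechet_derivative (\<lambda>z. coord N (f p) (f (uncoord M p z))) (at (coord M p p))"

text \<open>The components of a vector field in an arbitrary chart, as a function of the coordinates:
  the value at \<open>q\<close> is transported from the selected chart at \<open>q\<close> to the given one.\<close>

definition field_rep ::
  "('a, 'e::real_inner) smooth_mfd \<Rightarrow> ('a, 'e) chart \<Rightarrow> ('a \<Rightarrow> 'e) \<Rightarrow> 'e \<Rightarrow> 'e" where
  "field_rep M c X z =
     (let q = inv_into (fst c) (snd c) z
      in frechet_derivative (\<lambda>w. snd c (uncoord M q w)) (at (coord M q q)) (X q))"

definition smooth_field :: "('a, 'e::real_inner) smooth_mfd \<Rightarrow> ('a \<Rightarrow> 'e) \<Rightarrow> bool" where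
  "smooth_field M X \<longleftrightarrow> (\<forall>c \<in> atlas M. smooth_on (snd c ` fst c) (field_rep M c X))"

text \<open>Sign convention: \<open>[X, Y] = XY - YX\<close> as operators on functions, that is
  \<open>DY X - DX Y\<close> in coordinates.\<close>

definition lie_bracket ::
  "('a, 'e::real_inner) smooth_mfd \<Rightarrow> ('a \<Rightarrow> 'e) \<Rightarrow> ('a \<Rightarrow> 'e) \<Rightarrow> 'a \<Rightarrow> 'e" where
  "lie_bracket M X Y p =
     frechet_derivative (field_rep M (pchart M p) Y) (at (coord M p p)) (X p) -
     frechet_derivative (field_rep M (pchart M p) X) (at (coord M p p)) (Y p)"

text \<open>The curve \<open>\<gamma>\<close>, defined on \<open>S\<close> and continuous, has velocity \<open>v\<close> at time \<open>t\<close>.\<close>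

definition has_velocity ::
  "('a, 'e::real_inner) smooth_mfd \<Rightarrow> (real \<Rightarrow> 'a) \<Rightarrow> 'e \<Rightarrow> real \<Rightarrow> real set \<Rightarrow> bool" where
  "has_velocity M \<gamma> v t S \<longleftrightarrow>
     ((\<lambda>s. coord M (\<gamma> t) (\<gamma> s)) has_vector_derivative v) (at t within S)"


section \<open>Lie groups\<close>

record ('a, 'e) lie_grp = "'a monoid" +
  mfd :: "('a, 'e) smooth_mfd"

definition lie_group :: "('a, 'e::real_inner) lie_grp \<Rightarrow> bool" where
  "lie_group G \<longleftrightarrow> group G \<and> manifold (mfd G) \<and> topspace (mtop (mfd G)) = carrier G \<and>
     smooth_map (prod_mfd (mfd G) (mfd G)) (mfd G) (\<lambda>(g, h). g \<otimes>\<^bsub>G\<^esub> h) \<and>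
     smooth_map (mfd G) (mfd G) (\<lambda>g. inv\<^bsub>G\<^esub> g)"

definition connected_lie_group :: "('a, 'e::real_inner) lie_grp \<Rightarrow> bool" where
  "connected_lie_group G \<longleftrightarrow> lie_group G \<and> connected_space (mtop (mfd G))"

definition lie_automorphism :: "('a, 'e::real_inner) lie_grp \<Rightarrow> ('a \<Rightarrow> 'a) \<Rightarrow> bool" where
  "lie_automorphism G f \<longleftrightarrow> f \<in> iso G G \<and> smooth_map (mfd G) (mfd G) f \<and>
     smooth_map (mfd G) (mfd G) (inv_into (carrier G) f)"

text \<open>The Lie algebra of \<open>G\<close>, as a vector space, is the tangent space at the identity, hence the
  model space; \<open>right_field G v\<close> is the right-invariant vector field with value \<open>v\<close> at the
  identity.\<close>

definition right_field :: "('a, 'e::real_inner) lie_grp \<Rightarrow> 'e \<Rightarrow> 'a \<Rightarrow> 'e" where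
  "right_field G v g = mdiff (mfd G) (mfd G) (\<lambda>k. k \<otimes>\<^bsub>G\<^esub> g) \<one>\<^bsub>G\<^esub> v"

definition right_invariant_field :: "('a, 'e::real_inner) lie_grp \<Rightarrow> ('a \<Rightarrow> 'e) \<Rightarrow> bool" where
  "right_invariant_field G Y \<longleftrightarrow> smooth_field (mfd G) Y \<and>
     (\<forall>g \<in> carrier G. \<forall>h \<in> carrier G.
        mdiff (mfd G) (mfd G) (\<lambda>k. k \<otimes>\<^bsub>G\<^esub> h) g (Y g) = Y (g \<otimes>\<^bsub>G\<^esub> h))"

text \<open>\<open>H\<close> is the connected Lie subgroup of \<open>G\<close> with Lie algebra \<open>\<hh>\<close>. It carries its own
  topology and smooth structure; it is immersed and need not be embedded.\<close>

definition connected_lie_subgroup ::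
  "('a, 'e::real_inner) lie_grp \<Rightarrow> 'e set \<Rightarrow> ('a, 'f::real_inner) lie_grp \<Rightarrow> bool" where
  "connected_lie_subgroup G \<hh> H \<longleftrightarrow> connected_lie_group H \<and>
     subgroup (carrier H) G \<and>
     (\<forall>h \<in> carrier H. \<forall>k \<in> carrier H. h \<otimes>\<^bsub>H\<^esub> k = h \<otimes>\<^bsub>G\<^esub> k) \<and>
     smooth_map (mfd H) (mfd G) (\<lambda>h. h) \<and>
     (\<forall>h \<in> carrier H. inj (mdiff (mfd H) (mfd G) (\<lambda>h. h) h)) \<and>
     range (mdiff (mfd H) (mfd G) (\<lambda>h. h) \<one>\<^bsub>H\<^esub>) = \<hh>"

text \<open>The restriction to a Lie subgroup \<open>H\<close> of a vector field of \<open>G\<close> that is tangent to \<open>H\<close>.\<close>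

definition restrict_field ::
  "('a, 'e::real_inner) lie_grp \<Rightarrow> ('a, 'f::real_inner) lie_grp \<Rightarrow>
   ('a \<Rightarrow> 'e) \<Rightarrow> 'a \<Rightarrow> 'f" where
  "restrict_field G H Y h = (THE v. mdiff (mfd H) (mfd G) (\<lambda>h. h) h v = Y h)"


section \<open>Linear vector fields and the hyperbolic decomposition\<close>

definition linear_field_with_flow ::
  "('a, 'e::real_inner) lie_grp \<Rightarrow> ('a \<Rightarrow> 'e) \<Rightarrow> (real \<Rightarrow> 'a \<Rightarrow> 'a) \<Rightarrow> bool" where
  "linear_field_with_flow G X \<phi> \<longleftrightarrow> smooth_field (mfd G) X \<and>
     (\<forall>t. lie_automorphism G (\<phi> t)) \<and>
     (\<forall>g \<in> carrier G. \<phi> 0 g = g) \<and>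
     (\<forall>s t. \<forall>g \<in> carrier G. \<phi> (s + t) g = \<phi> s (\<phi> t g)) \<and>
     (\<forall>g \<in> carrier G. continuous_map euclideanreal (mtop (mfd G)) (\<lambda>t. \<phi> t g) \<and>
        (\<forall>t. has_velocity (mfd G) (\<lambda>t. \<phi> t g) (X (\<phi> t g)) t UNIV))"

definition assoc_derivation ::
  "('a, 'e::real_inner) lie_grp \<Rightarrow> ('a \<Rightarrow> 'e) \<Rightarrow> 'e \<Rightarrow> 'e" where
  "assoc_derivation G X v = - lie_bracket (mfd G) X (right_field G v) \<one>\<^bsub>G\<^esub>"

text \<open>The complexification of a real space \<open>V\<close> is \<open>V \<times> V\<close>, where \<open>(x, y)\<close> stands for
  \<open>x + \<i> y\<close>. A real operator \<open>D\<close> acts on it as \<open>map_prod D D\<close>.\<close>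

definition cscale :: "complex \<Rightarrow> 'e \<times> 'e \<Rightarrow> ('e::real_vector) \<times> 'e" where
  "cscale z w = (Re z *\<^sub>R fst w - Im z *\<^sub>R snd w, Re z *\<^sub>R snd w + Im z *\<^sub>R fst w)"

definition complex_eigenvalue :: "('e::real_vector \<Rightarrow> 'e) \<Rightarrow> complex \<Rightarrow> bool" where
  "complex_eigenvalue D z \<longleftrightarrow> (\<exists>w. w \<noteq> (0, 0) \<and> map_prod D D w = cscale z w)"

definition complex_gen_eigenspace :: "('e::real_vector \<Rightarrow> 'e) \<Rightarrow> complex \<Rightarrow> ('e \<times> 'e) set" where
  "complex_gen_eigenspace D z = {w. \<exists>n. ((\<lambda>w. map_prod D D w - cscale z w) ^^ n) w = 0}"

text \<open>The real generalized eigenspace for the pair \<open>z, cnj z\<close>: the real parts of the complex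
  generalized eigenvectors.\<close>

definition real_gen_eigenspace :: "('e::real_vector \<Rightarrow> 'e) \<Rightarrow> complex \<Rightarrow> 'e set" where
  "real_gen_eigenspace D z = fst ` complex_gen_eigenspace D z"

definition hyperbolic :: "('a, 'e::real_inner) lie_grp \<Rightarrow> ('a \<Rightarrow> 'e) \<Rightarrow> bool" where
  "hyperbolic G X \<longleftrightarrow> (\<forall>z. complex_eigenvalue (assoc_derivation G X) z \<longrightarrow> Re z \<noteq> 0)"

definition lie_plus :: "('a, 'e::real_inner) lie_grp \<Rightarrow> ('a \<Rightarrow> 'e) \<Rightarrow> 'e set" where
  "lie_plus G X = span (\<Union>z\<in>{z. complex_eigenvalue (assoc_derivation G X) z \<and> Re z > 0}.
     real_gen_eigenspace (assoc_derivation G X) z)"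

definition lie_minus :: "('a, 'e::real_inner) lie_grp \<Rightarrow> ('a \<Rightarrow> 'e) \<Rightarrow> 'e set" where
  "lie_minus G X = span (\<Union>z\<in>{z. complex_eigenvalue (assoc_derivation G X) z \<and> Re z < 0}.
     real_gen_eigenspace (assoc_derivation G X) z)"

definition direct_sum_decomposition :: "('e::real_vector) set \<Rightarrow> 'e set \<Rightarrow> bool" where
  "direct_sum_decomposition V W \<longleftrightarrow> V \<inter> W = {0} \<and> {v + w | v w. v \<in> V \<and> w \<in> W} = UNIV"


section \<open>Control systems\<close>

text \<open>A control with finitely many components, indexed by \<open>I\<close>, is a function of type
  \<open>real \<Rightarrow> 'i \<Rightarrow> real\<close>; components outside \<open>I\<close> carry no information and are set to \<open>0\<close>.
  Shifts are by \<open>s \<ge> 0\<close>, and the concatenation of \<open>u\<close> and \<open>v\<close> at time \<open>s \<ge> 0\<close> starts \<open>v\<close> from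
  its own time \<open>0\<close>. Classes of controls on the whole time line that are closed under all
  shifts, and classes of controls on the half line, are both covered.\<close>

definition control_class :: "'i set \<Rightarrow> (real \<Rightarrow> 'i \<Rightarrow> real) set \<Rightarrow> bool" where
  "control_class I \<U> \<longleftrightarrow>
     (\<forall>u\<in>\<U>. (\<forall>t. \<forall>i. i \<notin> I \<longrightarrow> u t i = 0) \<and>
        (\<forall>i\<in>I. (\<lambda>t. u t i) \<in> borel_measurable lebesgue) \<and>
        (\<forall>a b. \<exists>B. \<forall>t\<in>{a..b}. \<forall>i\<in>I. \<bar>u t i\<bar> \<le> B)) \<and>
     (\<lambda>t i. 0) \<in> \<U> \<and>
     (\<forall>u\<in>\<U>. \<forall>s\<ge>0. (\<lambda>t. u (t + s)) \<in> \<U>) \<and>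
     (\<forall>u\<in>\<U>. \<forall>v\<in>\<U>. \<forall>s\<ge>0. (\<lambda>t. if t < s then u t else v (t - s)) \<in> \<U>)"

definition join_controls ::
  "(real \<Rightarrow> 'i \<Rightarrow> real) \<Rightarrow> (real \<Rightarrow> 'j \<Rightarrow> real) \<Rightarrow> real \<Rightarrow> 'i + 'j \<Rightarrow> real" where
  "join_controls u v t = case_sum (u t) (v t)"

text \<open>Here \<open>d division_of T\<close> ranges over all finite families \<open>d\<close> of non-overlapping compact
  intervals with union \<open>T\<close>.\<close>

definition abs_continuous_on :: "real \<Rightarrow> real \<Rightarrow> (real \<Rightarrow> 'e::real_inner) \<Rightarrow> bool" where
  "abs_continuous_on a b f \<longleftrightarrow>
     (\<forall>\<epsilon>>0. \<exists>\<delta>>0. \<forall>d T. d division_of T \<and> T \<subseteq> {a..b} \<and> (\<Sum>K\<in>d. Sup K - Inf K) < \<delta> \<longrightarrow>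
        (\<Sum>K\<in>d. norm (f (Sup K) - f (Inf K))) < \<epsilon>)"

text \<open>Trajectories on \<open>[0, T]\<close> of the time-dependent field \<open>F\<close> in the sense of Caratheodory:
  curves that are absolutely continuous in charts and have the prescribed velocity almost
  everywhere.\<close>

definition trajectory ::
  "('a, 'e::real_inner) smooth_mfd \<Rightarrow> (real \<Rightarrow> 'a \<Rightarrow> 'e) \<Rightarrow> real \<Rightarrow> (real \<Rightarrow> 'a) \<Rightarrow> bool" where
  "trajectory M F T \<gamma> \<longleftrightarrow>
     continuous_map (top_of_set {0..T}) (mtop M) \<gamma> \<and>
     (\<forall>(U, x) \<in> atlas M. \<forall>a b. 0 \<le> a \<and> a \<le> b \<and> b \<le> T \<and> \<gamma> ` {a..b} \<subseteq> U \<longrightarrow>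
        abs_continuous_on a b (x \<circ> \<gamma>)) \<and>
     (AE t in lborel. t \<in> {0..T} \<longrightarrow> has_velocity M \<gamma> (F t (\<gamma> t)) t {0..T})"

definition system_field ::
  "('a \<Rightarrow> 'e::real_inner) \<Rightarrow> 'i set \<Rightarrow> ('i \<Rightarrow> 'a \<Rightarrow> 'e) \<Rightarrow> (real \<Rightarrow> 'i \<Rightarrow> real) \<Rightarrow>
   real \<Rightarrow> 'a \<Rightarrow> 'e" where
  "system_field X I Y u t g = X g + (\<Sum>i\<in>I. u t i *\<^sub>R Y i g)"

definition controllable ::
  "('a, 'e::real_inner) smooth_mfd \<Rightarrow> ('a \<Rightarrow> 'e) \<Rightarrow> 'i set \<Rightarrow> ('i \<Rightarrow> 'a \<Rightarrow> 'e) \<Rightarrow>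
   (real \<Rightarrow> 'i \<Rightarrow> real) set \<Rightarrow> bool" where
  "controllable M X I Y \<U> \<longleftrightarrow>
     (\<forall>g \<in> topspace (mtop M). \<forall>h \<in> topspace (mtop M).
        \<exists>t\<ge>0. \<exists>u\<in>\<U>. \<exists>\<gamma>. trajectory M (system_field X I Y u) t \<gamma> \<and> \<gamma> 0 = g \<and> \<gamma> t = h)"

end

theory Submission
  imports Defs
begin

text \<open>If \<open>\<gamma>\<close> is a trajectory of a linear control system, then so is \<open>t \<mapsto> \<gamma> t \<cdot> \<phi>\<^sub>t(k)\<close> for every
  \<open>k\<close>, under the same control. Let \<open>g = b a\<close> and \<open>h = b' a'\<close> with \<open>b, b' \<in> G\<^sup>-\<close> and \<open>a, a' \<in> G\<^sup>+\<close>.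
  Steering \<open>b\<close> to \<open>e\<close> inside \<open>G\<^sup>-\<close>, in time \<open>t\<close>, takes \<open>g\<close> to \<open>\<phi>\<^sub>t(a) \<in> G\<^sup>+\<close>. Let \<open>s\<close> be a time in
  which \<open>e\<close> can be steered to \<open>b'\<close> inside \<open>G\<^sup>-\<close>. Steering \<open>\<phi>\<^sub>t(a)\<close> to \<open>\<phi>\<^bsub>-s\<^esub>(a')\<close> inside \<open>G\<^sup>+\<close> and
  then \<open>e\<close> to \<open>b'\<close> inside \<open>G\<^sup>-\<close> ends at \<open>b' \<phi>\<^sub>s(\<phi>\<^bsub>-s\<^esub>(a')) = h\<close>.\<close>

section \<open>Continuously differentiable maps\<close>

text \<open>Right translation leaves a passive factor behind: while the left factor is steered, the
  right one drifts with the flow for a duration dictated by the steering. The phases are arranged so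
  that this drift is harmless. In the phases inside \<open>Gm\<close> the passive factor lies in
  \<open>Gp\<close>, where \<phi> restricts to a flow, so it stays there; in the middle phase it is
  the identity, which every automorphism fixes. The duration of the last phase depends only on the
  steering in \<open>Gm\<close> and not on the passive factor, so the drift it will cause can be
  undone in advance through the target of the middle phase.

  The rest is calculus. Velocities are read in one selected chart per point, while absolute
  continuity is demanded in every chart; both have to be transported through products, the
  multiplication and the inclusions of the subgroups. The identities for the linear field and for
  the restricted control fields come from differentiating one curve in two ways.\<close>

definition orthonormal_basis :: "'e::real_inner set \<Rightarrow> bool" where
  "orthonormal_basis B \<longleftrightarrow>
     finite B \<and> pairwise orthogonal B \<and> (\<forall>b\<in>B. norm b = 1) \<and> span B = UNIV"

text \<open>\<open>Ck_on\<close> provides continuity of the derivative in each fixed direction only.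
  Bounding a linear map by its values on finitely many directions turns this into local control of
  the operator norm.\<close>

lemma orthonormal_basis_norm_le:
  assumes B: "orthonormal_basis B" and f: "bounded_linear f"
  shows "norm (f v) \<le> (\<Sum>b\<in>B. norm (f b)) * norm v"
proof -
  interpret bounded_linear f by (rule f)
  have v: "(\<Sum>b\<in>B. (v \<bullet> b) *\<^sub>R b) = v"
    using B by (intro orthonormal_basis_expand) (auto simp: orthonormal_basis_def)
  have "norm (f v) = norm (\<Sum>b\<in>B. (v \<bullet> b) *\<^sub>R f b)"
    by (subst v[symmetric]) (simp add: sum scaleR)
  also have "\<dots> \<le> (\<Sum>b\<in>B. norm ((v \<bullet> b) *\<^sub>R f b))"
    by (rule norm_sum)
  also have "\<dots> \<le> (\<Sum>b\<in>B. norm (f b) * norm v)"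
  proof (rule sum_mono)
    fix b assume "b \<in> B"
    then have "\<bar>v \<bullet> b\<bar> \<le> norm v"
      using Cauchy_Schwarz_ineq2[of v b] B by (simp add: orthonormal_basis_def)
    then show "norm ((v \<bullet> b) *\<^sub>R f b) \<le> norm (f b) * norm v"
      using mult_right_mono[of "\<bar>v \<bullet> b\<bar>" "norm v" "norm (f b)"] by (simp add: mult.commute)
  qed
  finally show ?thesis by (simp add: sum_distrib_right)
qed

text \<open>Needed for the model space of the product manifold, on which the group multiplication is
  defined.\<close>

lemma orthonormal_basis_prod:
  assumes B: "orthonormal_basis B" and C: "orthonormal_basis C"
  shows "orthonormal_basis ((\<lambda>b. (b, 0)) ` B \<union> (\<lambda>c. (0, c)) ` C)"
    (is "orthonormal_basis ?D")
proof -
  have "(v, w) \<in> span ?D" for v w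
  proof -
    have v: "(\<Sum>b\<in>B. (v \<bullet> b) *\<^sub>R b) = v"
      using B by (intro orthonormal_basis_expand) (auto simp: orthonormal_basis_def)
    have w: "(\<Sum>c\<in>C. (w \<bullet> c) *\<^sub>R c) = w"
      using C by (intro orthonormal_basis_expand) (auto simp: orthonormal_basis_def)
    have "(v, w) = (\<Sum>b\<in>B. (v \<bullet> b) *\<^sub>R (b, 0)) + (\<Sum>c\<in>C. (w \<bullet> c) *\<^sub>R (0, c))"
      by (simp add: prod_eq_iff fst_sum snd_sum v w)
    also have "\<dots> \<in> span ?D"
      by (intro span_add span_sum span_scale span_base) auto
    finally show ?thesis .
  qed
  then have "span ?D = UNIV" by auto
  moreover have "x \<bullet> y = 0" if "x \<in> ?D" "y \<in> ?D" "x \<noteq> y" for x y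
    using that
  proof (elim UnE imageE)
    fix b b' assume "b \<in> B" "b' \<in> B" "x = (b, 0)" "y = (b', 0)"
    then show ?thesis
      using that(3) B pairwiseD[of orthogonal B b b'] by (simp add: orthonormal_basis_def orthogonal_def)
  next
    fix c c' assume "c \<in> C" "c' \<in> C" "x = (0, c)" "y = (0, c')"
    then show ?thesis
      using that(3) C pairwiseD[of orthogonal C c c'] by (simp add: orthonormal_basis_def orthogonal_def)
  qed simp_all
  moreover have "norm x = 1" if "x \<in> ?D" for x
    using that B C by (elim UnE imageE) (simp_all add: orthonormal_basis_def norm_prod_def)
  moreover have "finite ?D"
    using B C by (simp add: orthonormal_basis_def)
  ultimately show ?thesis
    unfolding orthonormal_basis_def pairwise_def orthogonal_def by blast
qed

text \<open>The sum of the norms of the derivatives along the basis is continuous, so on a small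
  ball it stays below its value at \<open>z\<close> plus one. It dominates the operator norm, and a
  ball is convex, so the mean value inequality applies.\<close>

lemma C1_locally_lipschitz:
  fixes f :: "'e::real_inner \<Rightarrow> 'f::real_normed_vector" and B :: "'e set"
  assumes B: "orthonormal_basis B" and S: "open S" and f: "Ck_on (Suc 0) S f" and z: "z \<in> S"
  obtains r L where "r > 0" "ball z r \<subseteq> S"
    "\<And>u v. u \<in> ball z r \<Longrightarrow> v \<in> ball z r \<Longrightarrow> norm (f u - f v) \<le> L * norm (u - v)"
proof -
  let ?D = "\<lambda>x. frechet_derivative f (at x)"
  let ?K = "\<lambda>x. \<Sum>b\<in>B. norm (?D x b)"
  have D: "(f has_derivative ?D x) (at x)" if "x \<in> S" for x
    using f that by (simp add: frechet_derivative_works)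
  have "continuous_on S ?K"
    using f by (intro continuous_intros) simp
  then have "isCont ?K z"
    using S z by (simp add: continuous_on_eq_continuous_at)
  then obtain d where d: "d > 0" "\<And>x. dist x z < d \<Longrightarrow> dist (?K x) (?K z) < 1"
    unfolding continuous_at_eps_delta by (metis zero_less_one)
  obtain e where e: "e > 0" "ball z e \<subseteq> S"
    using S z open_contains_ball by blast
  define r where "r = min d e"
  have r: "r > 0" "ball z r \<subseteq> S" using d e by (auto simp: r_def)
  have on: "onorm (?D x) \<le> ?K z + 1" if x: "x \<in> ball z r" for x
  proof (rule onorm_bound)
    show "0 \<le> ?K z + 1" by (simp add: sum_nonneg)
    fix v
    have "x \<in> S" using x r by blast
    then have "norm (?D x v) \<le> ?K x * norm v"
      by (intro orthonormal_basis_norm_le B has_derivative_bounded_linear[OF D])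
    moreover have "?K x \<le> ?K z + 1"
      using d(2)[of x] x by (simp add: r_def dist_commute dist_real_def)
    ultimately show "norm (?D x v) \<le> (?K z + 1) * norm v"
      by (meson mult_right_mono norm_ge_zero order_trans)
  qed
  show thesis
  proof (rule that[OF r])
    fix u v assume uv: "u \<in> ball z r" "v \<in> ball z r"
    show "norm (f u - f v) \<le> (?K z + 1) * norm (u - v)"
    proof (rule differentiable_bound[OF convex_ball _ on uv])
      fix x assume "x \<in> ball z r"
      then show "(f has_derivative ?D x) (at x within ball z r)"
        using D r by (meson has_derivative_at_withinI subsetD)
    qed
  qed
qed


section \<open>Absolutely continuous curves\<close>

text \<open>Endpoint pairs can be mapped and filtered directly, which sets of intervals do not allow
  as easily; all later arguments about absolute continuity use this form.\<close>

lemma abs_continuous_on_iff_pairs: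
  "abs_continuous_on a b f \<longleftrightarrow>
     (\<forall>\<epsilon>>0. \<exists>\<delta>>0. \<forall>P. finite P \<and> (\<forall>(p, q) \<in> P. a \<le> p \<and> p < q \<and> q \<le> b) \<and>
        pairwise (\<lambda>(p, q) (p', q'). {p<..<q} \<inter> {p'<..<q'} = {}) P \<and>
        (\<Sum>(p, q)\<in>P. q - p) < \<delta> \<longrightarrow> (\<Sum>(p, q)\<in>P. norm (f q - f p)) < \<epsilon>)"
    (is "?L \<longleftrightarrow> ?R")
proof
  assume L: ?L
  show ?R
  proof (intro allI impI)
    fix \<epsilon> :: real assume "\<epsilon> > 0"
    with L obtain \<delta> where \<delta>: "\<delta> > 0" and
      H: "\<And>d T. d division_of T \<Longrightarrow> T \<subseteq> {a..b} \<Longrightarrow> (\<Sum>K\<in>d. Sup K - Inf K) < \<delta> \<Longrightarrow>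
        (\<Sum>K\<in>d. norm (f (Sup K) - f (Inf K))) < \<epsilon>"
      unfolding abs_continuous_on_def by meson
    have "(\<Sum>(p, q)\<in>P. norm (f q - f p)) < \<epsilon>"
      if fin: "finite P" and le: "\<forall>(p, q) \<in> P. a \<le> p \<and> p < q \<and> q \<le> b"
        and dis: "pairwise (\<lambda>(p, q) (p', q'). {p<..<q} \<inter> {p'<..<q'} = {}) P"
        and len: "(\<Sum>(p, q)\<in>P. q - p) < \<delta>" for P
    proof -
      let ?I = "\<lambda>(p, q). {p..q::real}"
      have inj: "inj_on ?I P"
        using le by (fastforce simp: inj_on_def)
      have "(?I ` P) division_of \<Union>(?I ` P)"
        unfolding division_of_def
      proof (intro conjI ballI impI)
        fix K assume "K \<in> ?I ` P"
        then obtain p q where "(p, q) \<in> P" "K = {p..q}" by auto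
        then show "K \<subseteq> \<Union>(?I ` P)" "K \<noteq> {}" "\<exists>a b. K = cbox a b"
          using le by force+
      next
        fix K K' assume "K \<in> ?I ` P" "K' \<in> ?I ` P" "K \<noteq> K'"
        then obtain p q p' q' where "(p, q) \<in> P" "K = {p..q}" "(p', q') \<in> P" "K' = {p'..q'}"
          "(p, q) \<noteq> (p', q')" by auto
        then show "interior K \<inter> interior K' = {}"
          using pairwiseD[OF dis, of "(p, q)" "(p', q')"] by simp
      qed (use fin in auto)
      moreover have "\<Union>(?I ` P) \<subseteq> {a..b}" using le by fastforce
      moreover have eq: "(\<Sum>K\<in>?I ` P. g (Sup K) (Inf K)) = (\<Sum>(p, q)\<in>P. g q p)"
        for g :: "real \<Rightarrow> real \<Rightarrow> real"
        using le by (subst sum.reindex[OF inj]) (fastforce intro!: sum.cong)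
      ultimately show ?thesis
        using H[of "?I ` P" "\<Union>(?I ` P)"] len eq[of "\<lambda>q p. q - p"]
          eq[of "\<lambda>q p. norm (f q - f p)"] by simp
    qed
    with \<delta> show "\<exists>\<delta>>0. \<forall>P. finite P \<and> (\<forall>(p, q) \<in> P. a \<le> p \<and> p < q \<and> q \<le> b) \<and>
        pairwise (\<lambda>(p, q) (p', q'). {p<..<q} \<inter> {p'<..<q'} = {}) P \<and>
        (\<Sum>(p, q)\<in>P. q - p) < \<delta> \<longrightarrow> (\<Sum>(p, q)\<in>P. norm (f q - f p)) < \<epsilon>"
      by blast
  qed
next
  assume R: ?R
  show ?L
    unfolding abs_continuous_on_def
  proof (intro allI impI)
    fix \<epsilon> :: real assume "\<epsilon> > 0"
    with R obtain \<delta> where \<delta>: "\<delta> > 0" and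
      H: "\<And>P. finite P \<Longrightarrow> \<forall>(p, q) \<in> P. a \<le> p \<and> p < q \<and> q \<le> b \<Longrightarrow>
        pairwise (\<lambda>(p, q) (p', q'). {p<..<q} \<inter> {p'<..<q'} = {}) P \<Longrightarrow>
        (\<Sum>(p, q)\<in>P. q - p) < \<delta> \<Longrightarrow> (\<Sum>(p, q)\<in>P. norm (f q - f p)) < \<epsilon>"
      by meson
    have "(\<Sum>K\<in>d. norm (f (Sup K) - f (Inf K))) < \<epsilon>"
      if d: "d division_of T" and T: "T \<subseteq> {a..b}" and len: "(\<Sum>K\<in>d. Sup K - Inf K) < \<delta>" for d T
    proof -
      \<comment> \<open>A division may contain one-point intervals, which the pairs exclude by
        \<open>p < q\<close>. They add nothing to either sum and are dropped.\<close>
      define d' where "d' = {K\<in>d. Inf K < Sup K}"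
      let ?I = "\<lambda>K::real set. (Inf K, Sup K)"
      have fin: "finite d" using d by blast
      have K: "{Inf K..Sup K} = K" "a \<le> Inf K" "Inf K \<le> Sup K" "Sup K \<le> b" if K: "K \<in> d" for K
      proof -
        obtain p q where "K = {p..q}" "K \<noteq> {}" "K \<subseteq> {a..b}"
          using division_ofD(2-4)[OF d K] T by (metis box_real(2) order_trans)
        then show "{Inf K..Sup K} = K" "a \<le> Inf K" "Inf K \<le> Sup K" "Sup K \<le> b" by auto
      qed
      have inj: "inj_on ?I d'"
        using K(1) unfolding inj_on_def d'_def by (metis (no_types, lifting) mem_Collect_eq prod.inject)
      have "pairwise (\<lambda>(p, q) (p', q'). {p<..<q} \<inter> {p'<..<q'} = {}) (?I ` d')"
      proof (rule pairwiseI)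
        fix x y assume "x \<in> ?I ` d'" "y \<in> ?I ` d'" "x \<noteq> y"
        then obtain K K' where xy: "x = ?I K" "y = ?I K'" and KK: "K \<in> d'" "K' \<in> d'" "K \<noteq> K'"
          by blast
        then have "interior K \<inter> interior K' = {}"
          using division_ofD(5)[OF d, of K K'] by (auto simp: d'_def)
        moreover have "interior K = {Inf K<..<Sup K}" "interior K' = {Inf K'<..<Sup K'}"
          using K(1)[of K] K(1)[of K'] KK interior_atLeastAtMost_real[of "Inf K" "Sup K"]
            interior_atLeastAtMost_real[of "Inf K'" "Sup K'"] by (simp_all add: d'_def)
        ultimately show "(case x of (p, q) \<Rightarrow> \<lambda>(p', q'). {p<..<q} \<inter> {p'<..<q'} = {}) y"
          by (simp add: xy)
      qed
      \<comment> \<open>For arbitrary \<open>g\<close>, since it is used both for the lengths and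
        for the increments of \<open>f\<close>. Vanishing on the diagonal makes the dropped
        one-point intervals invisible.\<close>
      moreover have eq: "(\<Sum>(p, q)\<in>?I ` d'. g q p) = (\<Sum>K\<in>d. g (Sup K) (Inf K))"
        if "\<And>x. g x x = 0" for g :: "real \<Rightarrow> real \<Rightarrow> real"
      proof -
        have "(\<Sum>(p, q)\<in>?I ` d'. g q p) = (\<Sum>K\<in>d'. g (Sup K) (Inf K))"
          by (simp add: sum.reindex[OF inj])
        also have "\<dots> = (\<Sum>K\<in>d. g (Sup K) (Inf K))"
        proof (rule sum.mono_neutral_left[OF fin])
          show "d' \<subseteq> d" by (auto simp: d'_def)
          show "\<forall>K\<in>d - d'. g (Sup K) (Inf K) = 0"
          proof
            fix K assume "K \<in> d - d'"
            then have "\<not> Inf K < Sup K" "Inf K \<le> Sup K" using K(3)[of K] by (auto simp: d'_def)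
            then have "Inf K = Sup K" by simp
            then show "g (Sup K) (Inf K) = 0" using that by simp
          qed
        qed
        finally show ?thesis .
      qed
      ultimately show ?thesis
        using H[of "?I ` d'"] eq[of "\<lambda>q p. q - p"] eq[of "\<lambda>q p. norm (f q - f p)"] len K(2,4) fin
        by (auto simp: d'_def)
    qed
    with \<delta> show "\<exists>\<delta>>0. \<forall>d T. d division_of T \<and> T \<subseteq> {a..b} \<and> (\<Sum>K\<in>d. Sup K - Inf K) < \<delta> \<longrightarrow>
        (\<Sum>K\<in>d. norm (f (Sup K) - f (Inf K))) < \<epsilon>"
      by blast
  qed
qed

lemmas abs_continuous_onI = abs_continuous_on_iff_pairs[THEN iffD2, rule_format]

lemma abs_continuous_onE:
  assumes "abs_continuous_on a b f" "\<epsilon> > 0"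
  obtains \<delta> where "\<delta> > 0" "\<And>P. finite P \<Longrightarrow> (\<And>p q. (p, q) \<in> P \<Longrightarrow> a \<le> p \<and> p < q \<and> q \<le> b) \<Longrightarrow>
     pairwise (\<lambda>(p, q) (p', q'). {p<..<q} \<inter> {p'<..<q'} = {}) P \<Longrightarrow>
     (\<Sum>(p, q)\<in>P. q - p) < \<delta> \<Longrightarrow> (\<Sum>(p, q)\<in>P. norm (f q - f p)) < \<epsilon>"
  using assms unfolding abs_continuous_on_iff_pairs by (smt (verit) case_prodI2)

text \<open>Compares the increments of two functions instead of composing with a Lipschitz map. In
  this form it also gives the congruence rule, the sum of two functions, and, with the identity as
  \<open>f\<close>, absolute continuity of Lipschitz functions of time.\<close>

lemma abs_continuous_on_lipschitz:
  assumes f: "abs_continuous_on a b f"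
    and L: "\<And>s t. s \<in> {a..b} \<Longrightarrow> t \<in> {a..b} \<Longrightarrow> norm (g s - g t) \<le> L * norm (f s - f t)"
  shows "abs_continuous_on a b g"
proof (rule abs_continuous_onI)
  fix \<epsilon> :: real assume "\<epsilon> > 0"
  \<comment> \<open>\<open>L\<close> may be zero or negative; \<open>K\<close> is positive, so that
    \<open>\<epsilon> / K\<close> is a legitimate tolerance for \<open>f\<close>.\<close>
  define K where "K = \<bar>L\<bar> + 1"
  have K: "K > 0" by (simp add: K_def)
  have LK: "norm (g s - g t) \<le> K * norm (f s - f t)" if "s \<in> {a..b}" "t \<in> {a..b}" for s t
    using L[OF that] by (smt (verit) K_def mult_right_mono norm_ge_zero)
  obtain \<delta> where \<delta>: "\<delta> > 0" and
    H: "\<And>P. finite P \<Longrightarrow> (\<And>p q. (p, q) \<in> P \<Longrightarrow> a \<le> p \<and> p < q \<and> q \<le> b) \<Longrightarrow>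
     pairwise (\<lambda>(p, q) (p', q'). {p<..<q} \<inter> {p'<..<q'} = {}) P \<Longrightarrow>
     (\<Sum>(p, q)\<in>P. q - p) < \<delta> \<Longrightarrow> (\<Sum>(p, q)\<in>P. norm (f q - f p)) < \<epsilon> / K"
    using abs_continuous_onE[OF f, of "\<epsilon> / K"] K \<open>\<epsilon> > 0\<close> by (metis divide_pos_pos)
  have "(\<Sum>(p, q)\<in>P. norm (g q - g p)) < \<epsilon>"
    if P: "finite P" "\<forall>(p, q) \<in> P. a \<le> p \<and> p < q \<and> q \<le> b"
      "pairwise (\<lambda>(p, q) (p', q'). {p<..<q} \<inter> {p'<..<q'} = {}) P"
      "(\<Sum>(p, q)\<in>P. q - p) < \<delta>" for P
  proof -
    have "(\<Sum>(p, q)\<in>P. norm (g q - g p)) \<le> (\<Sum>(p, q)\<in>P. K * norm (f q - f p))"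
      using P(2) by (intro sum_mono) (fastforce intro!: LK)
    also have "\<dots> = K * (\<Sum>(p, q)\<in>P. norm (f q - f p))"
      by (simp add: sum_distrib_left case_prod_unfold)
    also have "\<dots> < \<epsilon>"
      using H[of P] P K by (fastforce simp: field_simps)
    finally show ?thesis .
  qed
  with \<delta> show "\<exists>\<delta>>0. \<forall>P. finite P \<and> (\<forall>(p, q) \<in> P. a \<le> p \<and> p < q \<and> q \<le> b) \<and>
        pairwise (\<lambda>(p, q) (p', q'). {p<..<q} \<inter> {p'<..<q'} = {}) P \<and>
        (\<Sum>(p, q)\<in>P. q - p) < \<delta> \<longrightarrow> (\<Sum>(p, q)\<in>P. norm (g q - g p)) < \<epsilon>"
    by blast
qed

lemma abs_continuous_on_cong:
  assumes "abs_continuous_on a b f" "\<And>t. t \<in> {a..b} \<Longrightarrow> g t = f t"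
  shows "abs_continuous_on a b g"
  by (rule abs_continuous_on_lipschitz[OF assms(1), where L = 1]) (simp add: assms(2))

lemma abs_continuous_on_ident: "abs_continuous_on a b (\<lambda>t. t)"
proof (rule abs_continuous_onI)
  fix \<epsilon> :: real assume "\<epsilon> > 0"
  have "(\<Sum>(p, q)\<in>P. norm (q - p)) < \<epsilon>"
    if "\<forall>(p, q) \<in> P. a \<le> p \<and> p < q \<and> q \<le> b" "(\<Sum>(p, q)\<in>P. q - p) < \<epsilon>" for P
  proof -
    have "(\<Sum>(p, q)\<in>P. norm (q - p)) = (\<Sum>(p, q)\<in>P. q - p)"
      using that(1) by (intro sum.cong) auto
    with that(2) show ?thesis by simp
  qed
  with \<open>\<epsilon> > 0\<close> show "\<exists>\<delta>>0. \<forall>P. finite P \<and> (\<forall>(p, q) \<in> P. a \<le> p \<and> p < q \<and> q \<le> b) \<and>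
        pairwise (\<lambda>(p, q) (p', q'). {p<..<q} \<inter> {p'<..<q'} = {}) P \<and>
        (\<Sum>(p, q)\<in>P. q - p) < \<delta> \<longrightarrow> (\<Sum>(p, q)\<in>P. norm (q - p)) < \<epsilon>"
    by blast
qed

lemma abs_continuous_on_Pair:
  assumes f: "abs_continuous_on a b f" and g: "abs_continuous_on a b g"
  shows "abs_continuous_on a b (\<lambda>t. (f t, g t))"
proof (rule abs_continuous_onI)
  fix \<epsilon> :: real assume "\<epsilon> > 0"
  obtain \<delta> where \<delta>: "\<delta> > 0" and
    F: "\<And>P. finite P \<Longrightarrow> (\<And>p q. (p, q) \<in> P \<Longrightarrow> a \<le> p \<and> p < q \<and> q \<le> b) \<Longrightarrow>
     pairwise (\<lambda>(p, q) (p', q'). {p<..<q} \<inter> {p'<..<q'} = {}) P \<Longrightarrow>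
     (\<Sum>(p, q)\<in>P. q - p) < \<delta> \<Longrightarrow> (\<Sum>(p, q)\<in>P. norm (f q - f p)) < \<epsilon> / 2"
    using abs_continuous_onE[OF f, of "\<epsilon> / 2"] \<open>\<epsilon> > 0\<close> by (metis half_gt_zero)
  obtain \<delta>' where \<delta>': "\<delta>' > 0" and
    G: "\<And>P. finite P \<Longrightarrow> (\<And>p q. (p, q) \<in> P \<Longrightarrow> a \<le> p \<and> p < q \<and> q \<le> b) \<Longrightarrow>
     pairwise (\<lambda>(p, q) (p', q'). {p<..<q} \<inter> {p'<..<q'} = {}) P \<Longrightarrow>
     (\<Sum>(p, q)\<in>P. q - p) < \<delta>' \<Longrightarrow> (\<Sum>(p, q)\<in>P. norm (g q - g p)) < \<epsilon> / 2"
    using abs_continuous_onE[OF g, of "\<epsilon> / 2"] \<open>\<epsilon> > 0\<close> by (metis half_gt_zero)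
  have "(\<Sum>(p, q)\<in>P. norm ((f q, g q) - (f p, g p))) < \<epsilon>"
    if P: "finite P" "\<forall>(p, q) \<in> P. a \<le> p \<and> p < q \<and> q \<le> b"
      "pairwise (\<lambda>(p, q) (p', q'). {p<..<q} \<inter> {p'<..<q'} = {}) P"
      "(\<Sum>(p, q)\<in>P. q - p) < min \<delta> \<delta>'" for P
  proof -
    have "(\<Sum>(p, q)\<in>P. norm ((f q, g q) - (f p, g p)))
        \<le> (\<Sum>(p, q)\<in>P. norm (f q - f p) + norm (g q - g p))"
      by (intro sum_mono) (auto simp: norm_Pair_le)
    also have "\<dots> = (\<Sum>(p, q)\<in>P. norm (f q - f p)) + (\<Sum>(p, q)\<in>P. norm (g q - g p))"
      by (simp add: sum.distrib case_prod_unfold)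
    also have "\<dots> < \<epsilon> / 2 + \<epsilon> / 2"
      using P by (intro add_strict_mono F G) auto
    finally show ?thesis by simp
  qed
  moreover have "min \<delta> \<delta>' > 0" using \<delta> \<delta>' by simp
  ultimately show "\<exists>\<delta>>0. \<forall>P. finite P \<and> (\<forall>(p, q) \<in> P. a \<le> p \<and> p < q \<and> q \<le> b) \<and>
        pairwise (\<lambda>(p, q) (p', q'). {p<..<q} \<inter> {p'<..<q'} = {}) P \<and>
        (\<Sum>(p, q)\<in>P. q - p) < \<delta> \<longrightarrow> (\<Sum>(p, q)\<in>P. norm ((f q, g q) - (f p, g p))) < \<epsilon>"
    by blast
qed

text \<open>A monotone map that does not increase distances sends non-overlapping intervals to
  non-overlapping intervals of no greater total length, so the \<delta> of \<open>f\<close> serves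
  unchanged. Since \<open>h\<close> may be constant on pieces, this covers the clamping maps
  \<open>min t c\<close> and \<open>max t c\<close> as well as time shifts.\<close>

lemma abs_continuous_on_reparam:
  assumes f: "abs_continuous_on a b f"
    and h: "\<And>s t. a' \<le> s \<Longrightarrow> s \<le> t \<Longrightarrow> t \<le> b' \<Longrightarrow> a \<le> h s \<and> h s \<le> h t \<and> h t \<le> b \<and> h t - h s \<le> t - s"
  shows "abs_continuous_on a' b' (\<lambda>t. f (h t))"
proof (rule abs_continuous_onI)
  fix \<epsilon> :: real assume "\<epsilon> > 0"
  obtain \<delta> where \<delta>: "\<delta> > 0" and
    F: "\<And>P. finite P \<Longrightarrow> (\<And>p q. (p, q) \<in> P \<Longrightarrow> a \<le> p \<and> p < q \<and> q \<le> b) \<Longrightarrow>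
     pairwise (\<lambda>(p, q) (p', q'). {p<..<q} \<inter> {p'<..<q'} = {}) P \<Longrightarrow>
     (\<Sum>(p, q)\<in>P. q - p) < \<delta> \<Longrightarrow> (\<Sum>(p, q)\<in>P. norm (f q - f p)) < \<epsilon>"
    using abs_continuous_onE[OF f \<open>\<epsilon> > 0\<close>] by blast
  have "(\<Sum>(p, q)\<in>P. norm (f (h q) - f (h p))) < \<epsilon>"
    if P: "finite P" "\<forall>(p, q) \<in> P. a' \<le> p \<and> p < q \<and> q \<le> b'"
      "pairwise (\<lambda>(p, q) (p', q'). {p<..<q} \<inter> {p'<..<q'} = {}) P"
      "(\<Sum>(p, q)\<in>P. q - p) < \<delta>" for P
  proof -
    \<comment> \<open>Intervals that \<open>h\<close> collapses to a point contribute no increment.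
      On the others \<open>map_prod h h\<close> is injective, so the sums can be reindexed.\<close>
    define Q where "Q = {(p, q) \<in> P. h p < h q}"
    have "Q \<subseteq> P" by (auto simp: Q_def)
    with P(1) have Q: "finite Q" "Q \<subseteq> P" by (auto intro: finite_subset)
    have sep: "h q \<le> h p' \<or> h q' \<le> h p"
      if "(p, q) \<in> P" "(p', q') \<in> P" "(p, q) \<noteq> (p', q')" for p q p' q'
    proof -
      have le: "a' \<le> p" "p < q" "q \<le> b'" "a' \<le> p'" "p' < q'" "q' \<le> b'"
        using P(2) that by auto
      have "{p<..<q} \<inter> {p'<..<q'} = {}" using P(3) that by (fastforce simp: pairwise_def)
      \<comment> \<open>The midpoint of a nontrivial overlap would lie in both open
        intervals.\<close>
      moreover have "(max p p' + min q q') / 2 \<in> {p<..<q} \<inter> {p'<..<q'}" if "max p p' < min q q'"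
        using that le by (auto simp: max_def min_def field_simps split: if_splits)
      ultimately have "min q q' \<le> max p p'" by fastforce
      then have "q \<le> p' \<or> q' \<le> p" using le by linarith
      then show ?thesis using h[of q p'] h[of q' p] le by auto
    qed
    have inj: "inj_on (map_prod h h) Q"
    proof (rule inj_onI, clarify)
      fix p q p' q' assume "(p, q) \<in> Q" "(p', q') \<in> Q" "map_prod h h (p, q) = map_prod h h (p', q')"
      then have "(p, q) \<in> P" "(p', q') \<in> P" "h p < h q" "h p = h p'" "h q = h q'"
        by (auto simp: Q_def)
      then show "p = p' \<and> q = q'" using sep[of p q p' q'] by auto
    qed
    have "(\<Sum>(p, q)\<in>P. norm (f (h q) - f (h p))) = (\<Sum>(p, q)\<in>Q. norm (f (h q) - f (h p)))"
    proof (rule sum.mono_neutral_right[OF P(1) Q(2)], clarify)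
      fix p q assume "(p, q) \<in> P" "(p, q) \<notin> Q"
      then have "h p = h q" using P(2) h[of p q] by (auto simp: Q_def)
      then show "norm (f (h q) - f (h p)) = 0" by simp
    qed
    also have "\<dots> = (\<Sum>(p, q)\<in>map_prod h h ` Q. norm (f q - f p))"
      by (simp add: sum.reindex[OF inj] case_prod_unfold)
    also have "\<dots> < \<epsilon>"
    proof (rule F)
      show "finite (map_prod h h ` Q)" using Q by simp
      have hP: "a \<le> h p \<and> h q \<le> b \<and> h q - h p \<le> q - p \<and> p < q" if "(p, q) \<in> P" for p q
        using P(2) h[of p q] that by auto
      show "a \<le> p \<and> p < q \<and> q \<le> b" if "(p, q) \<in> map_prod h h ` Q" for p q
        using that hP by (auto simp: Q_def)
      show "pairwise (\<lambda>(p, q) (p', q'). {p<..<q} \<inter> {p'<..<q'} = {}) (map_prod h h ` Q)"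
      proof (rule pairwiseI)
        fix z z' assume "z \<in> map_prod h h ` Q" and z'Q: "z' \<in> map_prod h h ` Q" and "z \<noteq> z'"
        then obtain p q where z: "z = (h p, h q)" and P: "(p, q) \<in> P"
          using Q(2) by auto
        from z'Q obtain p' q' where z': "z' = (h p', h q')" and P': "(p', q') \<in> P"
          using Q(2) by auto
        with z z' \<open>z \<noteq> z'\<close> have "(p, q) \<noteq> (p', q')" by auto
        with z z' show "(case z of (p, q) \<Rightarrow> \<lambda>(p', q'). {p<..<q} \<inter> {p'<..<q'} = {}) z'"
          using sep[OF P P'] by auto
      qed
      have "(\<Sum>(p, q)\<in>map_prod h h ` Q. q - p) = (\<Sum>(p, q)\<in>Q. h q - h p)"
        by (simp add: sum.reindex[OF inj] case_prod_unfold)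
      also have "\<dots> \<le> (\<Sum>(p, q)\<in>Q. q - p)"
        using hP Q(2) by (intro sum_mono) auto
      also have "\<dots> \<le> (\<Sum>(p, q)\<in>P. q - p)"
        using hP by (intro sum_mono2 P Q) (auto simp: less_imp_le)
      finally show "(\<Sum>(p, q)\<in>map_prod h h ` Q. q - p) < \<delta>" using P(4) by simp
    qed
    finally show ?thesis .
  qed
  with \<delta> show "\<exists>\<delta>>0. \<forall>P. finite P \<and> (\<forall>(p, q) \<in> P. a' \<le> p \<and> p < q \<and> q \<le> b') \<and>
        pairwise (\<lambda>(p, q) (p', q'). {p<..<q} \<inter> {p'<..<q'} = {}) P \<and>
        (\<Sum>(p, q)\<in>P. q - p) < \<delta> \<longrightarrow> (\<Sum>(p, q)\<in>P. norm (f (h q) - f (h p))) < \<epsilon>"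
    by blast
qed

text \<open>The pieces are extended by constants, so that \<open>f = f (min t c) + f (max t c) - f c\<close>.\<close>

lemma abs_continuous_on_combine:
  assumes 1: "abs_continuous_on a c f" and 2: "abs_continuous_on c b f" and c: "a \<le> c" "c \<le> b"
  shows "abs_continuous_on a b f"
proof -
  have "abs_continuous_on a b (\<lambda>t. f (min t c))"
    by (rule abs_continuous_on_reparam[OF 1]) (use c in auto)
  moreover have "abs_continuous_on a b (\<lambda>t. f (max t c))"
    by (rule abs_continuous_on_reparam[OF 2]) (use c in auto)
  ultimately have "abs_continuous_on a b (\<lambda>t. (f (min t c), f (max t c)))"
    by (rule abs_continuous_on_Pair)
  then show ?thesis
  proof (rule abs_continuous_on_lipschitz[where L = 2])
    fix s t
    let ?x = "f (min s c) - f (min t c)" and ?y = "f (max s c) - f (max t c)"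
    have "f s - f t = ?x + ?y" by (auto simp: min_def max_def)
    then have "norm (f s - f t) \<le> norm ?x + norm ?y" by (metis norm_triangle_ineq)
    also have "\<dots> \<le> 2 * norm (?x, ?y)"
      using norm_fst_le[of ?x ?y] norm_snd_le[of ?y ?x] by simp
    finally show "norm (f s - f t)
      \<le> 2 * norm ((f (min s c), f (max s c)) - (f (min t c), f (max t c)))" by simp
  qed
qed

section \<open>Curves in manifolds\<close>

text \<open>Collects the conditions on individual charts; these pass to \<open>prod_mfd\<close> one
  product chart at a time.\<close>

definition charted :: "('a, 'e::real_inner) smooth_mfd \<Rightarrow> bool" where
  "charted M \<longleftrightarrow> (\<exists>B::'e set. orthonormal_basis B) \<and>
     \<Union> (fst ` atlas M) = topspace (mtop M) \<and>
     (\<forall>(U, x) \<in> atlas M. openin (mtop M) U \<and> open (x ` U) \<and>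
        homeomorphic_map (subtopology (mtop M) U) (top_of_set (x ` U)) x)"

lemma manifold_charted: "manifold M \<Longrightarrow> charted M"
  unfolding manifold_def charted_def orthonormal_basis_def by blast

text \<open>The chart representations of the identity are the transition maps. A change of chart
  thereby becomes an instance of the chain rule.\<close>

lemma manifold_smooth_map_ident: "manifold M \<Longrightarrow> smooth_map M M (\<lambda>p. p)"
  by (auto simp: manifold_def smooth_map_def Int_def o_def)

lemma charted_prod:
  fixes M :: "('a, 'e::real_inner) smooth_mfd" and N :: "('b, 'f::real_inner) smooth_mfd"
  assumes M: "charted M" and N: "charted N"
  shows "charted (prod_mfd M N)"
  unfolding charted_def
proof (intro conjI ballI)
  show "\<exists>B::('e \<times> 'f) set. orthonormal_basis B"
    using M N orthonormal_basis_prod unfolding charted_def by blast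
  have "\<Union> (fst ` atlas M) \<times> \<Union> (fst ` atlas N) = \<Union> (fst ` atlas (prod_mfd M N))"
    by (force simp: prod_mfd_def)
  then show "\<Union> (fst ` atlas (prod_mfd M N)) = topspace (mtop (prod_mfd M N))"
    using M N by (simp add: charted_def prod_mfd_def)
next
  fix c assume "c \<in> atlas (prod_mfd M N)"
  then obtain U x V y where c: "c = (U \<times> V, map_prod x y)" and
    U: "(U, x) \<in> atlas M" and V: "(V, y) \<in> atlas N"
    by (auto simp: prod_mfd_def)
  have *: "openin (mtop M) U" "openin (mtop N) V" "open (x ` U)" "open (y ` V)"
    and h: "homeomorphic_map (subtopology (mtop M) U) (top_of_set (x ` U)) x"
    "homeomorphic_map (subtopology (mtop N) V) (top_of_set (y ` V)) y"
    using M N U V by (auto simp: charted_def)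
  obtain x' y' where "homeomorphic_maps (subtopology (mtop M) U) (top_of_set (x ` U)) x x'"
    "homeomorphic_maps (subtopology (mtop N) V) (top_of_set (y ` V)) y y'"
    using h unfolding homeomorphic_map_maps by blast
  then have "homeomorphic_maps (prod_topology (subtopology (mtop M) U) (subtopology (mtop N) V))
      (prod_topology (top_of_set (x ` U)) (top_of_set (y ` V)))
      (\<lambda>(p, q). (x p, y q)) (\<lambda>(p, q). (x' p, y' q))"
    unfolding homeomorphic_maps_prod by blast
  then have "homeomorphic_map (prod_topology (subtopology (mtop M) U) (subtopology (mtop N) V))
      (prod_topology (top_of_set (x ` U)) (top_of_set (y ` V))) (\<lambda>(p, q). (x p, y q))"
    unfolding homeomorphic_map_maps by blast
  moreover have "top_of_set (x ` U \<times> y ` V)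
      = prod_topology (top_of_set (x ` U)) (top_of_set (y ` V))"
    by simp
  moreover have "map_prod x y ` (U \<times> V) = x ` U \<times> y ` V"
    by (rule map_prod_surj_on[OF refl refl])
  moreover have "map_prod x y = (\<lambda>(p, q). (x p, y q))"
    by (simp add: map_prod_def)
  ultimately have "homeomorphic_map (subtopology (mtop (prod_mfd M N)) (U \<times> V))
      (top_of_set (map_prod x y ` (U \<times> V))) (map_prod x y)"
    unfolding prod_mfd_def smooth_mfd.simps subtopology_Times by metis
  moreover have "openin (mtop (prod_mfd M N)) (U \<times> V)" "open (map_prod x y ` (U \<times> V))"
    using * by (simp_all add: prod_mfd_def openin_prod_Times_iff open_Times map_prod_surj_on[OF refl refl])
  ultimately show "case c of (U, x) \<Rightarrow> openin (mtop (prod_mfd M N)) U \<and> open (x ` U) \<and>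
        homeomorphic_map (subtopology (mtop (prod_mfd M N)) U) (top_of_set (x ` U)) x"
    by (simp only: c case_prod_conv)
qed

section \<open>Topology and differentiation in a single chart\<close>

context
  fixes M :: "('a, 'e::real_inner) smooth_mfd" and U x
  assumes M: "charted M" and c: "(U, x) \<in> atlas M"
begin

lemma chart_inj: "inj_on x U"
  and chart_openin: "openin (mtop M) U"
  and chart_subset: "U \<subseteq> topspace (mtop M)"
proof -
  have *: "openin (mtop M) U" "homeomorphic_map (subtopology (mtop M) U) (top_of_set (x ` U)) x"
    using M c by (auto simp: charted_def)
  then show "openin (mtop M) U" "U \<subseteq> topspace (mtop M)"
    by (auto simp: openin_subset)
  then show "inj_on x U"
    using homeomorphic_imp_injective_map[OF *(2)] by (simp add: Int_absorb1)
qed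

lemma chart_image_open:
  assumes "openin (mtop M) W" "W \<subseteq> U"
  shows "open (x ` W)"
proof -
  have h: "open (x ` U)" "homeomorphic_map (subtopology (mtop M) U) (top_of_set (x ` U)) x"
    using M c by (auto simp: charted_def)
  have "openin (subtopology (mtop M) U) W"
    using assms by (metis inf.absorb1 openin_subtopology)
  then have "openin (top_of_set (x ` U)) (x ` W)"
    using homeomorphic_imp_open_map[OF h(2)] by (simp add: open_map_def)
  then show ?thesis using h(1) by (simp add: openin_open_eq)
qed

lemma chart_vimage_openin:
  assumes "open S"
  shows "openin (mtop M) {p \<in> U. x p \<in> S}"
proof -
  have "homeomorphic_map (subtopology (mtop M) U) (top_of_set (x ` U)) x"
    using M c by (auto simp: charted_def)
  then have "continuous_map (subtopology (mtop M) U) euclidean x"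
    by (metis continuous_map_in_subtopology homeomorphic_imp_continuous_map)
  then have "openin (subtopology (mtop M) U) {p \<in> topspace (subtopology (mtop M) U). x p \<in> S}"
    by (rule openin_continuous_map_preimage) (use assms in simp)
  then have "openin (mtop M) {p \<in> topspace (subtopology (mtop M) U). x p \<in> S}"
    using chart_openin openin_trans_full by blast
  then show ?thesis
    using chart_subset by (simp add: Int_absorb1)
qed

lemma chart_domain_open:
  assumes f: "smooth_map M N f" and N: "charted N" and d: "(V, y) \<in> atlas N"
  shows "open (x ` {p \<in> U. f p \<in> V})"
proof (rule chart_image_open)
  have V: "openin (mtop N) V" using N d by (auto simp: charted_def)
  have "openin (mtop M) (U \<inter> {p \<in> topspace (mtop M). f p \<in> V})"
    using f openin_continuous_map_preimage[OF _ V] chart_openin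
    by (intro openin_Int) (auto simp: smooth_map_def)
  moreover have "U \<inter> {p \<in> topspace (mtop M). f p \<in> V} = {p \<in> U. f p \<in> V}"
    using chart_subset by blast
  ultimately show "openin (mtop M) {p \<in> U. f p \<in> V}" by simp
qed auto

lemma chart_map_C1:
  assumes f: "smooth_map M N f" and d: "(V, y) \<in> atlas N"
  shows "Ck_on (Suc 0) (x ` {p \<in> U. f p \<in> V}) (\<lambda>z. y (f (inv_into U x z)))"
proof -
  have "smooth_on (x ` {p \<in> U. f p \<in> V}) (y \<circ> f \<circ> inv_into U x)"
    using f c d unfolding smooth_map_def by blast
  then have "Ck_on (Suc 0) (x ` {p \<in> U. f p \<in> V}) (y \<circ> f \<circ> inv_into U x)"
    unfolding smooth_on_def by blast
  then show ?thesis by (simp only: o_def)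
qed

lemma chart_map_has_derivative:
  assumes f: "smooth_map M N f" and d: "(V, y) \<in> atlas N" and p: "p \<in> U" "f p \<in> V"
  shows "((\<lambda>z. y (f (inv_into U x z))) has_derivative
    frechet_derivative (\<lambda>z. y (f (inv_into U x z))) (at (x p))) (at (x p))"
  using chart_map_C1[OF f d] p by (auto simp: frechet_derivative_works[symmetric])

end

text \<open>A chart map is arbitrary outside its domain, so \<open>has_velocity\<close> alone does
  not keep the curve near its point; continuity at \<open>t\<close> has to be carried separately. It
  is relative to \<open>S\<close> because trajectories live on \<open>{0..T}\<close> and flow lines
  on the whole line.\<close>

definition curve_cont :: "('a, 'e) smooth_mfd \<Rightarrow> (real \<Rightarrow> 'a) \<Rightarrow> real \<Rightarrow> real set \<Rightarrow> bool" where
  "curve_cont M \<gamma> t S \<longleftrightarrow> t \<in> S \<and> \<gamma> t \<in> topspace (mtop M) \<and>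
     (\<forall>W. openin (mtop M) W \<longrightarrow> \<gamma> t \<in> W \<longrightarrow> (\<forall>\<^sub>F s in at t within S. \<gamma> s \<in> W))"

lemma continuous_map_curve_cont:
  assumes \<gamma>: "continuous_map (top_of_set S) (mtop M) \<gamma>" and t: "t \<in> S"
  shows "curve_cont M \<gamma> t S"
  unfolding curve_cont_def
proof (intro conjI allI impI)
  show "\<gamma> t \<in> topspace (mtop M)"
    using \<gamma> t by (auto simp: continuous_map_def)
  fix W assume "openin (mtop M) W" and W: "\<gamma> t \<in> W"
  then have "openin (top_of_set S) {s \<in> S. \<gamma> s \<in> W}"
    using openin_continuous_map_preimage[OF \<gamma>] by simp
  then obtain A where "open A" "{s \<in> S. \<gamma> s \<in> W} = S \<inter> A"
    by (auto simp: openin_open)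
  then show "\<forall>\<^sub>F s in at t within S. \<gamma> s \<in> W"
    using t W unfolding eventually_at_topological by blast
qed (rule t)

text \<open>The chain rule, where \<open>inv_into U x\<close> undoes \<open>x\<close> only while the
  curve stays in \<open>U\<close>; continuity at \<open>t\<close> guarantees this nearby. Arbitrary
  charts are allowed so that the lemma also covers product charts and changes of chart.\<close>

lemma chart_velocity_map:
  assumes M: "charted M" and N: "charted N" and f: "smooth_map M N f"
    and c: "(U, x) \<in> atlas M" and d: "(V, y) \<in> atlas N" and p: "\<gamma> t \<in> U" "f (\<gamma> t) \<in> V"
    and \<gamma>: "curve_cont M \<gamma> t S" and w: "((\<lambda>s. x (\<gamma> s)) has_vector_derivative w) (at t within S)"
  shows "((\<lambda>s. y (f (\<gamma> s))) has_vector_derivative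
    frechet_derivative (\<lambda>z. y (f (inv_into U x z))) (at (x (\<gamma> t))) w) (at t within S)"
proof -
  let ?h = "\<lambda>z. y (f (inv_into U x z))"
  let ?D = "frechet_derivative ?h (at (x (\<gamma> t)))"
  have D: "(?h has_derivative ?D) (at (x (\<gamma> t)))"
    using chart_map_has_derivative[OF M c f d p] .
  interpret D: bounded_linear ?D using D by (rule has_derivative_bounded_linear)
  have "((\<lambda>s. ?h (x (\<gamma> s))) has_derivative (\<lambda>r. ?D (r *\<^sub>R w))) (at t within S)"
    using has_derivative_compose[OF w[unfolded has_vector_derivative_def] D] .
  then have "((\<lambda>s. y (f (\<gamma> s))) has_derivative (\<lambda>r. ?D (r *\<^sub>R w))) (at t within S)"
  proof (rule has_derivative_transform_eventually)
    have inv: "inv_into U x (x q) = q" if "q \<in> U" for q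
      using chart_inj[OF M c] that by simp
    then show "?h (x (\<gamma> t)) = y (f (\<gamma> t))" using p by simp
    have "\<forall>\<^sub>F s in at t within S. \<gamma> s \<in> U"
      using \<gamma> p chart_openin[OF M c] by (auto simp: curve_cont_def)
    then show "\<forall>\<^sub>F s in at t within S. ?h (x (\<gamma> s)) = y (f (\<gamma> s))"
      by eventually_elim (simp add: inv)
    show "t \<in> S" using \<gamma> by (simp add: curve_cont_def)
  qed
  then show ?thesis
    by (simp add: has_vector_derivative_def D.scaleR)
qed

lemma pchart:
  assumes "charted M" "p \<in> topspace (mtop M)"
  shows "pchart M p \<in> atlas M" "p \<in> fst (pchart M p)"
proof -
  have "\<exists>c. c \<in> atlas M \<and> p \<in> fst c"
  proof -
    have "p \<in> \<Union> (fst ` atlas M)" using assms unfolding charted_def by simp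
    then show ?thesis by blast
  qed
  then show "pchart M p \<in> atlas M" "p \<in> fst (pchart M p)"
    unfolding pchart_def by (metis (mono_tags, lifting) someI_ex)+
qed

lemma pchart_pair:
  assumes "charted M" "p \<in> topspace (mtop M)"
  shows "(fst (pchart M p), coord M p) \<in> atlas M"
  using pchart[OF assms] by (simp add: coord_def)

lemma mdiff_bounded_linear:
  assumes M: "charted M" and N: "charted N" and f: "smooth_map M N f"
    and p: "p \<in> topspace (mtop M)"
  shows "bounded_linear (mdiff M N f p)"
proof -
  have "f p \<in> topspace (mtop N)"
    using f p by (auto simp: smooth_map_def continuous_map_def)
  then show ?thesis
    unfolding mdiff_def uncoord_def using chart_map_has_derivative[OF M pchart_pair[OF M p] f pchart_pair[OF N]]
      pchart[OF M p] pchart[OF N]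
    by (metis coord_def has_derivative_bounded_linear)
qed

lemma has_velocity_map:
  assumes M: "charted M" and N: "charted N" and f: "smooth_map M N f"
    and \<gamma>: "curve_cont M \<gamma> t S" and v: "has_velocity M \<gamma> v t S"
  shows "has_velocity N (\<lambda>s. f (\<gamma> s)) (mdiff M N f (\<gamma> t) v) t S"
proof -
  have p: "\<gamma> t \<in> topspace (mtop M)" using \<gamma> by (simp add: curve_cont_def)
  then have q: "f (\<gamma> t) \<in> topspace (mtop N)"
    using f by (auto simp: smooth_map_def continuous_map_def)
  show ?thesis
    using chart_velocity_map[OF M N f pchart_pair[OF M p] pchart_pair[OF N q] pchart(2)[OF M p]
        pchart(2)[OF N q] \<gamma>] v
    by (simp add: has_velocity_def mdiff_def uncoord_def coord_def)
qed

text \<open>The device behind several identities between tangent vectors: compute the velocity of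
  one curve in two ways.\<close>

lemma has_velocity_unique:
  assumes "has_velocity M \<gamma> v t UNIV" "has_velocity M \<gamma> w t UNIV"
  shows "v = w"
  using assms unfolding has_velocity_def by (rule vector_derivative_unique_at)

section \<open>Absolutely continuous curves in manifolds\<close>

definition ac_curve :: "('a, 'e::real_inner) smooth_mfd \<Rightarrow> real \<Rightarrow> (real \<Rightarrow> 'a) \<Rightarrow> bool" where
  "ac_curve M T \<gamma> \<longleftrightarrow> continuous_map (top_of_set {0..T}) (mtop M) \<gamma> \<and>
     (\<forall>(U, x) \<in> atlas M. \<forall>a b. 0 \<le> a \<and> a \<le> b \<and> b \<le> T \<and> \<gamma> ` {a..b} \<subseteq> U \<longrightarrow>
        abs_continuous_on a b (x \<circ> \<gamma>))"

text \<open>Separates regularity from the differential equation: the former is transported chart by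
  chart, the latter pointwise at almost every time.\<close>

lemma trajectory_iff_ac_curve:
  "trajectory M F T \<gamma> \<longleftrightarrow> ac_curve M T \<gamma> \<and>
     (AE t in lborel. t \<in> {0..T} \<longrightarrow> has_velocity M \<gamma> (F t (\<gamma> t)) t {0..T})"
  by (simp add: trajectory_def ac_curve_def)

lemma ac_curve_subset:
  assumes "ac_curve M T \<gamma>" "t \<in> {0..T}"
  shows "\<gamma> t \<in> topspace (mtop M)" "curve_cont M \<gamma> t {0..T}"
  using assms continuous_map_curve_cont[of "{0..T}" M \<gamma> t] by (auto simp: ac_curve_def curve_cont_def)

lemma ac_curve_near:
  assumes "ac_curve M T \<gamma>" "t \<in> {0..T}" "openin (mtop M) W" "\<gamma> t \<in> W"
  obtains d where "d > 0" "\<And>s. s \<in> {0..T} \<Longrightarrow> \<bar>s - t\<bar> < d \<Longrightarrow> \<gamma> s \<in> W"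
proof -
  have "\<forall>\<^sub>F s in at t within {0..T}. \<gamma> s \<in> W"
    using ac_curve_subset(2)[OF assms(1,2)] assms by (simp add: curve_cont_def)
  then obtain d where "d > 0" "\<And>s. s \<in> {0..T} \<Longrightarrow> s \<noteq> t \<Longrightarrow> dist s t < d \<Longrightarrow> \<gamma> s \<in> W"
    unfolding eventually_at by blast
  then show thesis
    using that assms(4) by (metis dist_real_def)
qed

text \<open>Absolute continuity is local, and a continuously differentiable map is locally Lipschitz.\<close>

lemma ac_curve_map:
  assumes M: "charted M" and N: "charted N" and f: "smooth_map M N f" and \<gamma>: "ac_curve M T \<gamma>"
  shows "ac_curve N T (\<lambda>t. f (\<gamma> t))"
  unfolding ac_curve_def
proof (safe)
  have "continuous_map (top_of_set {0..T}) (mtop N) (f \<circ> \<gamma>)"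
    using \<gamma> f by (intro continuous_map_compose[where X' = "mtop M"])
      (simp_all only: ac_curve_def smooth_map_def)
  then show "continuous_map (top_of_set {0..T}) (mtop N) (\<lambda>t. f (\<gamma> t))"
    by (simp add: o_def)
next
  fix V y a b
  assume d: "(V, y) \<in> atlas N" and ab: "0 \<le> a" "a \<le> b" "b \<le> T"
    and V: "(\<lambda>t. f (\<gamma> t)) ` {a..b} \<subseteq> V"
  \<comment> \<open>\<open>Bolzano\<close> reduces the claim to additivity over adjacent intervals
    and to short intervals around each time. The premises, trivially true here, restrict the short
    intervals to \<open>{a..b}\<close>, where the image curve is known to stay in
    \<open>V\<close>.\<close>
  have "a \<le> a \<longrightarrow> b \<le> b \<longrightarrow> abs_continuous_on a b (y \<circ> (\<lambda>t. f (\<gamma> t)))"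
    using \<open>a \<le> b\<close>
  proof (rule Bolzano[of a b "\<lambda>p q. a \<le> p \<longrightarrow> q \<le> b \<longrightarrow> abs_continuous_on p q (y \<circ> (\<lambda>t. f (\<gamma> t)))"])
    fix p q r
    assume "a \<le> p \<longrightarrow> q \<le> b \<longrightarrow> abs_continuous_on p q (y \<circ> (\<lambda>t. f (\<gamma> t)))"
      "a \<le> q \<longrightarrow> r \<le> b \<longrightarrow> abs_continuous_on q r (y \<circ> (\<lambda>t. f (\<gamma> t)))" "p \<le> q" "q \<le> r"
    then show "a \<le> p \<longrightarrow> r \<le> b \<longrightarrow> abs_continuous_on p r (y \<circ> (\<lambda>t. f (\<gamma> t)))"
      using abs_continuous_on_combine[of p q _ r] by (meson order_trans)
  next
    fix t assume t: "a \<le> t" "t \<le> b"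
    then have tT: "t \<in> {0..T}" using ab by auto
    have "\<gamma> t \<in> topspace (mtop M)" using ac_curve_subset(1)[OF \<gamma> tT] .
    then obtain U x where c: "(U, x) \<in> atlas M" and tU: "\<gamma> t \<in> U"
      using pchart[OF M] by (metis prod.collapse)
    let ?S = "x ` {p \<in> U. f p \<in> V}" and ?h = "\<lambda>z. y (f (inv_into U x z))"
    obtain B :: "'b set" where B: "orthonormal_basis B" using M by (auto simp: charted_def)
    have "f (\<gamma> t) \<in> V" using V t by auto
    then have tS: "x (\<gamma> t) \<in> ?S" using tU by blast
    obtain r L where r: "r > 0" and "ball (x (\<gamma> t)) r \<subseteq> ?S" and
      L: "\<And>u v. u \<in> ball (x (\<gamma> t)) r \<Longrightarrow> v \<in> ball (x (\<gamma> t)) r \<Longrightarrow> norm (?h u - ?h v) \<le> L * norm (u - v)"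
      by (rule C1_locally_lipschitz[OF B chart_domain_open[OF M c f N d] chart_map_C1[OF M c f d] tS],
          rule that)
    \<comment> \<open>While the curve stays in this neighbourhood, its coordinates stay in the ball
      on which the chart expression of \<open>f\<close> is Lipschitz.\<close>
    let ?W = "{p \<in> U. x p \<in> ball (x (\<gamma> t)) r}"
    have "openin (mtop M) ?W" "\<gamma> t \<in> ?W"
      using chart_vimage_openin[OF M c open_ball] tU r by auto
    then obtain \<delta> where \<delta>: "\<delta> > 0" "\<And>s. s \<in> {0..T} \<Longrightarrow> \<bar>s - t\<bar> < \<delta> \<Longrightarrow> \<gamma> s \<in> ?W"
      using ac_curve_near[OF \<gamma> tT] by blast
    have "abs_continuous_on p q (y \<circ> (\<lambda>t. f (\<gamma> t)))"
      if pq: "p \<le> t" "t \<le> q" "q - p < \<delta>" "a \<le> p" "q \<le> b" for p q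
    proof -
      have W: "\<gamma> s \<in> ?W" if "s \<in> {p..q}" for s
        using that pq ab by (intro \<delta>) auto
      have "\<gamma> ` {p..q} \<subseteq> U" using W by auto
      moreover have "0 \<le> p" "p \<le> q" "q \<le> T" using pq ab by auto
      ultimately have "abs_continuous_on p q (x \<circ> \<gamma>)"
        using \<gamma> c unfolding ac_curve_def by blast
      then show ?thesis
      proof (rule abs_continuous_on_lipschitz[where L = L])
        fix s s' assume "s \<in> {p..q}" "s' \<in> {p..q}"
        then show "norm ((y \<circ> (\<lambda>t. f (\<gamma> t))) s - (y \<circ> (\<lambda>t. f (\<gamma> t))) s')
            \<le> L * norm ((x \<circ> \<gamma>) s - (x \<circ> \<gamma>) s')"
          using W[of s] W[of s'] L[of "x (\<gamma> s)" "x (\<gamma> s')"] chart_inj[OF M c] by simp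
      qed
    qed
    with \<delta>(1) show "\<exists>d>0. \<forall>p q. p \<le> t \<and> t \<le> q \<and> q - p < d \<longrightarrow>
        (a \<le> p \<longrightarrow> q \<le> b \<longrightarrow> abs_continuous_on p q (y \<circ> (\<lambda>t. f (\<gamma> t))))"
      by blast
  qed
  then show "abs_continuous_on a b (y \<circ> (\<lambda>t. f (\<gamma> t)))" by simp
qed

lemma ac_curve_Pair:
  assumes \<gamma>: "ac_curve M T \<gamma>" and \<eta>: "ac_curve N T \<eta>"
  shows "ac_curve (prod_mfd M N) T (\<lambda>t. (\<gamma> t, \<eta> t))"
  unfolding ac_curve_def
proof (safe)
  show "continuous_map (top_of_set {0..T}) (mtop (prod_mfd M N)) (\<lambda>t. (\<gamma> t, \<eta> t))"
    using \<gamma> \<eta> by (simp add: ac_curve_def prod_mfd_def continuous_map_paired)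
next
  fix W z a b
  assume "(W, z) \<in> atlas (prod_mfd M N)" and ab: "0 \<le> a" "a \<le> b" "b \<le> T"
    and W: "(\<lambda>t. (\<gamma> t, \<eta> t)) ` {a..b} \<subseteq> W"
  then obtain U x V y where "W = U \<times> V" and z: "z = map_prod x y" and
    U: "(U, x) \<in> atlas M" and V: "(V, y) \<in> atlas N"
    by (auto simp: prod_mfd_def)
  with W have "\<gamma> ` {a..b} \<subseteq> U" "\<eta> ` {a..b} \<subseteq> V" by auto
  then have "abs_continuous_on a b (x \<circ> \<gamma>)" "abs_continuous_on a b (y \<circ> \<eta>)"
    using \<gamma> \<eta> U V ab unfolding ac_curve_def by blast+
  then show "abs_continuous_on a b (z \<circ> (\<lambda>t. (\<gamma> t, \<eta> t)))"
    using abs_continuous_on_Pair[of a b "x \<circ> \<gamma>" "y \<circ> \<eta>"] by (simp add: z o_def)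
qed

text \<open>In any chart the velocity is a continuous function of time on a compact interval, hence
  bounded; by the mean value inequality the coordinate curve is Lipschitz.\<close>

lemma ac_curve_integral_curve:
  assumes M: "manifold M" and X: "smooth_field M X"
    and \<gamma>: "continuous_map euclideanreal (mtop M) \<gamma>"
    and v: "\<And>t. has_velocity M \<gamma> (X (\<gamma> t)) t UNIV"
  shows "ac_curve M T \<gamma>"
  unfolding ac_curve_def
proof (safe)
  show "continuous_map (top_of_set {0..T}) (mtop M) \<gamma>"
    using \<gamma> by (simp add: continuous_map_from_subtopology)
next
  fix U x a b
  assume c: "(U, x) \<in> atlas M" and ab: "0 \<le> a" "a \<le> b" "b \<le> T" and U: "\<gamma> ` {a..b} \<subseteq> U"
  note Mc = manifold_charted[OF M]
  have cc: "curve_cont M \<gamma> t UNIV" for t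
    using continuous_map_curve_cont[of UNIV M \<gamma> t] \<gamma> by simp
  let ?F = "\<lambda>t. field_rep M (U, x) X (x (\<gamma> t))"
  have D: "((x \<circ> \<gamma>) has_vector_derivative ?F t) (at t)" if t: "t \<in> {a..b}" for t
  proof -
    have p: "\<gamma> t \<in> topspace (mtop M)" "\<gamma> t \<in> U" using cc[of t] U t by (auto simp: curve_cont_def)
    have "inv_into U x (x (\<gamma> t)) = \<gamma> t" using chart_inj[OF Mc c] p by simp
    \<comment> \<open>Passing from the selected chart at \<open>\<gamma> t\<close> to
      \<open>x\<close> is the chain rule for the identity map, and the resulting vector is the one
      that defines \<open>field_rep\<close>.\<close>
    then show ?thesis
      using chart_velocity_map[OF Mc Mc manifold_smooth_map_ident[OF M] pchart_pair[OF Mc p(1)] c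
          pchart(2)[OF Mc p(1)] p(2) cc] v[of t]
      by (simp add: has_velocity_def field_rep_def uncoord_def coord_def o_def Let_def)
  qed
  have "continuous_on {a..b} (x \<circ> \<gamma>)"
    using D by (meson continuous_at_imp_continuous_on has_vector_derivative_continuous)
  moreover have "continuous_on (x ` U) (field_rep M (U, x) X)"
  proof -
    have "Ck_on 0 (x ` U) (field_rep M (U, x) X)"
      using X c unfolding smooth_field_def smooth_on_def by fastforce
    then show ?thesis by simp
  qed
  moreover have "(x \<circ> \<gamma>) ` {a..b} \<subseteq> x ` U" using U by auto
  ultimately have "continuous_on {a..b} (\<lambda>t. field_rep M (U, x) X ((x \<circ> \<gamma>) t))"
    by (metis continuous_on_compose2)
  then have "compact (?F ` {a..b})"
    by (intro compact_continuous_image) simp_all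
  then obtain L where L: "\<And>t. t \<in> {a..b} \<Longrightarrow> norm (?F t) \<le> L"
    by (metis bounded_iff compact_imp_bounded image_eqI)
  show "abs_continuous_on a b (x \<circ> \<gamma>)"
  proof (rule abs_continuous_on_lipschitz[OF abs_continuous_on_ident, where L = L])
    fix s t assume st: "s \<in> {a..b}" "t \<in> {a..b}"
    show "norm ((x \<circ> \<gamma>) s - (x \<circ> \<gamma>) t) \<le> L * norm (s - t)"
    proof (rule differentiable_bound[OF convex_real_interval(5) _ _ st])
      fix r assume r: "r \<in> {a..b}"
      show "((x \<circ> \<gamma>) has_derivative (\<lambda>u. u *\<^sub>R ?F r)) (at r within {a..b})"
        using D[OF r] by (simp add: has_vector_derivative_def has_derivative_at_withinI)
      show "onorm (\<lambda>u. u *\<^sub>R ?F r) \<le> L"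
        using mult_right_mono[OF L[OF r] abs_ge_zero] by (intro onorm_le) (simp add: mult.commute)
    qed
  qed
qed

section \<open>Images and concatenations of trajectories\<close>

lemma trajectory_map:
  assumes M: "charted M" and N: "charted N" and f: "smooth_map M N f"
    and \<gamma>: "trajectory M F T \<gamma>"
    and F: "\<And>t p. p \<in> topspace (mtop M) \<Longrightarrow> mdiff M N f p (F t p) = F' t (f p)"
  shows "trajectory N F' T (\<lambda>t. f (\<gamma> t))"
proof -
  have ac: "ac_curve M T \<gamma>"
    and v: "AE t in lborel. t \<in> {0..T} \<longrightarrow> has_velocity M \<gamma> (F t (\<gamma> t)) t {0..T}"
    using \<gamma> by (simp_all add: trajectory_iff_ac_curve)
  from v have "AE t in lborel. t \<in> {0..T} \<longrightarrow> has_velocity N (\<lambda>s. f (\<gamma> s)) (F' t (f (\<gamma> t))) t {0..T}"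
  proof eventually_elim
    case (elim t)
    then show ?case
      using has_velocity_map[OF M N f ac_curve_subset(2)[OF ac]] F ac_curve_subset(1)[OF ac] by metis
  qed
  then show ?thesis
    using ac_curve_map[OF M N f ac] by (simp add: trajectory_iff_ac_curve)
qed

text \<open>The exceptional set of \<open>P\<close> need not be Borel, so the translation is applied
  to a Borel null set containing it.\<close>

lemma AE_lborel_shift:
  fixes c :: real
  assumes "AE t in lborel. P t"
  shows "AE t in lborel. P (t - c)"
proof -
  obtain N where N: "{t. \<not> P t} \<subseteq> N" "emeasure lborel N = 0" "N \<in> sets borel"
    using assms by (auto elim!: AE_E)
  then have "AE t in lborel. t \<notin> N"
    by (intro AE_not_in) (simp add: null_sets_def)
  then have "AE t in lborel. - c + 1 * t \<notin> N"
    using N(3) by (intro AE_borel_affine) simp_all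
  then show ?thesis
    by eventually_elim (use N(1) in auto)
qed

text \<open>Away from the junction time each piece keeps its velocity. The field switches with
  \<open>t < T\<close> and the curve with \<open>t \<le> T\<close>; the curve values at
  \<open>T\<close> agree by \<open>eq\<close>.\<close>

lemma trajectory_concat:
  assumes 1: "trajectory M F T \<gamma>" and 2: "trajectory M F' T' \<gamma>'"
    and T: "0 \<le> T" "0 \<le> T'" and eq: "\<gamma> T = \<gamma>' 0"
  shows "trajectory M (\<lambda>t. if t < T then F t else F' (t - T)) (T + T')
    (\<lambda>t. if t \<le> T then \<gamma> t else \<gamma>' (t - T))" (is "trajectory M ?F _ ?c")
proof -
  have ac1: "ac_curve M T \<gamma>" and v1: "AE t in lborel. t \<in> {0..T} \<longrightarrow> has_velocity M \<gamma> (F t (\<gamma> t)) t {0..T}"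
    using 1 by (simp_all add: trajectory_iff_ac_curve)
  have ac2: "ac_curve M T' \<gamma>'"
    and v2: "AE t in lborel. t \<in> {0..T'} \<longrightarrow> has_velocity M \<gamma>' (F' t (\<gamma>' t)) t {0..T'}"
    using 2 by (simp_all add: trajectory_iff_ac_curve)
  have c2: "?c t = \<gamma>' (t - T)" if "t \<ge> T" for t
    using that eq by (cases "t = T") auto
  have "ac_curve M (T + T') ?c"
    unfolding ac_curve_def
  proof (safe)
    let ?X = "top_of_set {0..T + T'}"
    show "continuous_map ?X (mtop M) ?c"
    proof (rule continuous_map_cases_le)
      have "subtopology ?X {x. x \<in> topspace ?X \<and> x \<le> T} = top_of_set {0..T}"
        using T by (simp add: subtopology_subtopology) (rule arg_cong[where f = top_of_set], auto)
      then show "continuous_map (subtopology ?X {x. x \<in> topspace ?X \<and> x \<le> T}) (mtop M) \<gamma>"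
        using ac1 by (simp add: ac_curve_def)
      have "subtopology ?X {x. x \<in> topspace ?X \<and> T \<le> x} = top_of_set {T..T + T'}"
        using T by (simp add: subtopology_subtopology) (rule arg_cong[where f = top_of_set], auto)
      moreover have "continuous_map (top_of_set {T..T + T'}) (top_of_set {0..T'}) (\<lambda>t. t - T)"
        by (auto intro!: continuous_intros)
      then have "continuous_map (top_of_set {T..T + T'}) (mtop M) (\<gamma>' \<circ> (\<lambda>t. t - T))"
        by (rule continuous_map_compose) (use ac2 in \<open>simp add: ac_curve_def\<close>)
      ultimately show "continuous_map (subtopology ?X {x. x \<in> topspace ?X \<and> T \<le> x}) (mtop M) (\<lambda>t. \<gamma>' (t - T))"
        by (simp add: o_def)
    qed (use eq in auto)
  next
    fix U x a b
    assume c: "(U, x) \<in> atlas M" and ab: "0 \<le> a" "a \<le> b" "b \<le> T + T'" and U: "?c ` {a..b} \<subseteq> U"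
    \<comment> \<open>Subintervals on one side of \<open>T\<close> are treated by \<open>L\<close>
      and \<open>R\<close>; an interval that contains \<open>T\<close> is cut there.\<close>
    have L: "abs_continuous_on p q (x \<circ> ?c)" if pq: "a \<le> p" "p \<le> q" "q \<le> b" "q \<le> T" for p q
    proof -
      have "\<gamma> t \<in> U" if "t \<in> {p..q}" for t
        using U that pq by (auto simp: image_subset_iff split: if_splits)
      then have "\<gamma> ` {p..q} \<subseteq> U" by blast
      moreover have "0 \<le> p" using ab pq by simp
      ultimately have "abs_continuous_on p q (x \<circ> \<gamma>)"
        using ac1 c pq unfolding ac_curve_def by blast
      then show ?thesis
        by (rule abs_continuous_on_cong) (use pq in auto)
    qed
    have R: "abs_continuous_on p q (x \<circ> ?c)" if pq: "a \<le> p" "p \<le> q" "q \<le> b" "T \<le> p" for p q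
    proof -
      have "\<gamma>' t \<in> U" if "t \<in> {p - T..q - T}" for t
      proof -
        have "?c (t + T) \<in> U" using U that pq by (intro subsetD[OF U] imageI) auto
        also have "?c (t + T) = \<gamma>' (t + T - T)" using that pq by (intro c2) auto
        finally show ?thesis by simp
      qed
      then have "\<gamma>' ` {p - T..q - T} \<subseteq> U" by blast
      moreover have "0 \<le> p - T" "p - T \<le> q - T" "q - T \<le> T'" using ab pq by simp_all
      ultimately have "abs_continuous_on (p - T) (q - T) (x \<circ> \<gamma>')"
        using ac2 c unfolding ac_curve_def by blast
      then have "abs_continuous_on p q (\<lambda>t. (x \<circ> \<gamma>') (t - T))"
        by (rule abs_continuous_on_reparam) auto
      then show ?thesis
      proof (rule abs_continuous_on_cong)
        fix t assume "t \<in> {p..q}"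
        with pq have "?c t = \<gamma>' (t - T)" by (intro c2) simp
        then show "(x \<circ> ?c) t = (x \<circ> \<gamma>') (t - T)" by (simp only: o_def)
      qed
    qed
    consider "b \<le> T" | "T \<le> a" | "a \<le> T" "T \<le> b" by linarith
    then show "abs_continuous_on a b (x \<circ> ?c)"
    proof cases
      case 3
      then show ?thesis
        by (intro abs_continuous_on_combine[of a T _ b] L R) simp_all
    qed (use L R ab in simp_all)
  qed
  \<comment> \<open>The one-sided velocities at \<open>T\<close> may differ, so this single time
    joins the exceptional null set.\<close>
  moreover have "AE t in lborel. t \<in> {0..T + T'} \<longrightarrow> has_velocity M ?c (?F t (?c t)) t {0..T + T'}"
    using v1 AE_lborel_shift[OF v2, of T] AE_lborel_singleton[of T]
  proof eventually_elim
    case (elim t)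
    show ?case
    proof
      assume t: "t \<in> {0..T + T'}"
      show "has_velocity M ?c (?F t (?c t)) t {0..T + T'}"
      proof (cases "t < T")
        case True
        then have "((\<lambda>s. coord M (\<gamma> t) (\<gamma> s)) has_vector_derivative F t (\<gamma> t)) (at t within {0..T})"
          using elim t by (auto simp: has_velocity_def)
        \<comment> \<open>Times near some \<open>t < T\<close> lie below \<open>T\<close>, so
          enlarging the time interval beyond \<open>T\<close> does not change the derivative at
          \<open>t\<close>.\<close>
        moreover have "at t within {0..T} = at t within {0..T + T'}"
          by (rule at_within_nhd[of t "{..<T}"]) (use True T in auto)
        ultimately have "((\<lambda>s. coord M (\<gamma> t) (\<gamma> s)) has_vector_derivative F t (\<gamma> t)) (at t within {0..T + T'})"
          by simp
        then have "((\<lambda>s. coord M (\<gamma> t) (?c s)) has_vector_derivative F t (\<gamma> t)) (at t within {0..T + T'})"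
          by (rule has_vector_derivative_transform_within[where d = "T - t"])
            (use True t in \<open>auto simp: dist_real_def\<close>)
        then show ?thesis using True by (simp add: has_velocity_def)
      next
        case False
        with elim have tT: "t > T" by simp
        have im: "(\<lambda>s. s - T) ` {T..T + T'} = {0..T'}"
          using image_add_atLeastAtMost[of "- T" T "T + T'"] by simp
        let ?v = "F' (t - T) (\<gamma>' (t - T))" and ?x = "coord M (\<gamma>' (t - T))"
        have "((\<lambda>s. ?x (\<gamma>' s)) has_vector_derivative ?v) (at (t - T) within {0..T'})"
          using elim t tT by (auto simp: has_velocity_def)
        moreover have "((\<lambda>s. s - T) has_vector_derivative 1) (at t within {T..T + T'})"
          by (auto intro!: derivative_eq_intros)
        ultimately have "(((\<lambda>s. ?x (\<gamma>' s)) \<circ> (\<lambda>s. s - T)) has_vector_derivative 1 *\<^sub>R ?v) (at t within {T..T + T'})"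
          by (intro vector_diff_chain_within) (simp_all add: im)
        moreover have "at t within {T..T + T'} = at t within {0..T + T'}"
          by (rule at_within_nhd[of t "{T<..}"]) (use tT T in auto)
        ultimately have "((\<lambda>s. ?x (\<gamma>' (s - T))) has_vector_derivative ?v) (at t within {0..T + T'})"
          by (simp add: o_def)
        then have "((\<lambda>s. ?x (?c s)) has_vector_derivative ?v) (at t within {0..T + T'})"
          by (rule has_vector_derivative_transform_within[where d = "t - T"])
            (use tT t in \<open>auto simp: dist_real_def\<close>)
        then show ?thesis using tT by (simp add: has_velocity_def)
      qed
    qed
  qed
  ultimately show ?thesis by (simp add: trajectory_iff_ac_curve)
qed

section \<open>Elementary curves and curves with prescribed velocity\<close>

lemma curve_cont_const: "t \<in> S \<Longrightarrow> p \<in> topspace (mtop M) \<Longrightarrow> curve_cont M (\<lambda>_. p) t S"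
  by (simp add: curve_cont_def)

lemma has_velocity_const: "has_velocity M (\<lambda>_. p) 0 t S"
  by (simp add: has_velocity_def)

lemma curve_cont_map:
  assumes "continuous_map (mtop M) (mtop N) f" "curve_cont M \<gamma> t S"
  shows "curve_cont N (\<lambda>s. f (\<gamma> s)) t S"
  unfolding curve_cont_def
proof (intro conjI allI impI)
  fix W assume W: "openin (mtop N) W" "f (\<gamma> t) \<in> W"
  let ?V = "{p \<in> topspace (mtop M). f p \<in> W}"
  have "openin (mtop M) ?V" by (rule openin_continuous_map_preimage[OF assms(1) W(1)])
  moreover have "\<gamma> t \<in> ?V" using W(2) assms(2) by (simp add: curve_cont_def)
  ultimately have "\<forall>\<^sub>F s in at t within S. \<gamma> s \<in> ?V"
    using assms(2) unfolding curve_cont_def by blast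
  then show "\<forall>\<^sub>F s in at t within S. f (\<gamma> s) \<in> W"
    by eventually_elim simp
qed (use assms in \<open>auto simp: curve_cont_def continuous_map_def\<close>)

lemma curve_cont_Pair:
  assumes "curve_cont M \<gamma> t S" "curve_cont N \<eta> t S"
  shows "curve_cont (prod_mfd M N) (\<lambda>s. (\<gamma> s, \<eta> s)) t S"
  unfolding curve_cont_def
proof (intro conjI allI impI)
  fix W assume "openin (mtop (prod_mfd M N)) W" "(\<gamma> t, \<eta> t) \<in> W"
  then have "\<exists>U V. openin (mtop M) U \<and> openin (mtop N) V \<and> \<gamma> t \<in> U \<and> \<eta> t \<in> V \<and> U \<times> V \<subseteq> W"
    unfolding prod_mfd_def smooth_mfd.simps openin_prod_topology_alt by (elim allE impE)
  then obtain U V where "openin (mtop M) U" "openin (mtop N) V" "\<gamma> t \<in> U" "\<eta> t \<in> V" and W: "U \<times> V \<subseteq> W"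
    by (elim exE conjE)
  then have "\<forall>\<^sub>F s in at t within S. \<gamma> s \<in> U" "\<forall>\<^sub>F s in at t within S. \<eta> s \<in> V"
    using assms by (simp_all add: curve_cont_def)
  then show "\<forall>\<^sub>F s in at t within S. (\<gamma> s, \<eta> s) \<in> W"
    by eventually_elim (use W in auto)
qed (use assms in \<open>simp_all add: curve_cont_def prod_mfd_def\<close>)

text \<open>The straight line in the selected chart, set to the constant \<open>p\<close> where it
  leaves the chart image, so that it is a curve in the manifold for all times. It realizes a tangent
  vector as a velocity, which makes \<open>has_velocity_unique\<close> applicable.\<close>

lemma exists_curve_with_velocity:
  assumes M: "charted M" and p: "p \<in> topspace (mtop M)"
  obtains \<sigma> where "\<sigma> 0 = p" "\<And>s. \<sigma> s \<in> topspace (mtop M)" "curve_cont M \<sigma> 0 UNIV" "has_velocity M \<sigma> v 0 UNIV"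
proof -
  let ?U = "fst (pchart M p)" and ?x = "coord M p"
  let ?l = "\<lambda>s::real. ?x p + s *\<^sub>R v"
  define \<sigma> where "\<sigma> = (\<lambda>s. if ?l s \<in> ?x ` ?U then inv_into ?U ?x (?l s) else p)"
  note c = pchart_pair[OF M p]
  have pU: "p \<in> ?U" using pchart[OF M p] by simp
  have inv: "inv_into ?U ?x (?x q) = q" if "q \<in> ?U" for q
    using chart_inj[OF M c] that by simp
  have \<sigma>0: "\<sigma> 0 = p" by (simp add: \<sigma>_def inv pU)
  have l: "\<forall>\<^sub>F s in nhds 0. ?l s \<in> ?x ` W" if "openin (mtop M) W" "p \<in> W" "W \<subseteq> ?U" for W
  proof -
    have "isCont ?l 0" by (intro continuous_intros)
    moreover have "open (?x ` W)" by (rule chart_image_open[OF M c that(1,3)])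
    ultimately show ?thesis
      using that(2) by (auto simp: continuous_at_imp_continuous_on isCont_def tendsto_def
          intro!: eventually_nhds_conv_at[THEN iffD2])
  qed
  have near: "\<forall>\<^sub>F s in nhds 0. \<sigma> s \<in> W \<and> ?x (\<sigma> s) = ?l s" if "openin (mtop M) W" "p \<in> W" for W
  proof -
    have "\<forall>\<^sub>F s in nhds 0. ?l s \<in> ?x ` (W \<inter> ?U)"
      using that pU chart_openin[OF M c] by (intro l) (auto intro: openin_Int)
    then show ?thesis
      by eventually_elim (auto simp: \<sigma>_def inv)
  qed
  show thesis
  proof (rule that[of \<sigma>, OF \<sigma>0])
    show "\<sigma> s \<in> topspace (mtop M)" for s
      using p chart_subset[OF M c] by (auto simp: \<sigma>_def inv)
    show "curve_cont M \<sigma> 0 UNIV"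
      unfolding curve_cont_def
    proof (intro conjI allI impI)
      fix W assume W: "openin (mtop M) W" "\<sigma> 0 \<in> W"
      have "\<forall>\<^sub>F s in nhds 0. \<sigma> s \<in> W"
        using near[OF W(1)] W(2) by (auto simp: \<sigma>0 elim: eventually_mono)
      then show "\<forall>\<^sub>F s in at 0. \<sigma> s \<in> W"
        by (simp add: eventually_nhds_conv_at)
    qed (use p in \<open>simp_all add: \<sigma>0\<close>)
    have ev: "\<forall>\<^sub>F s in nhds 0. ?x (\<sigma> s) = ?l s"
      using near[OF openin_topspace p] by (auto elim: eventually_mono)
    have "(?l has_vector_derivative v) (at 0)"
      by (auto intro!: derivative_eq_intros)
    then have "((\<lambda>s. ?x (\<sigma> s)) has_vector_derivative v) (at 0)"
      using ev eventually_nhds_x_imp_x[OF ev]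
      by (subst has_vector_derivative_cong_ev) (auto elim: eventually_mono)
    then show "has_velocity M \<sigma> v 0 UNIV"
      by (simp add: has_velocity_def \<sigma>0)
  qed
qed

section \<open>Lie groups and linear systems\<close>

lemma lie_groupD:
  assumes "lie_group G"
  shows "group G" "manifold (mfd G)" "charted (mfd G)" "topspace (mtop (mfd G)) = carrier G"
    "smooth_map (prod_mfd (mfd G) (mfd G)) (mfd G) (\<lambda>(g, h). g \<otimes>\<^bsub>G\<^esub> h)"
  using assms manifold_charted by (auto simp: lie_group_def)

text \<open>The definition avoids \<open>mdiff\<close>, since the
  chart selected at a point of the product manifold need not be the product of the selected charts.\<close>

definition mult_diff :: "('a, 'e::real_inner) lie_grp \<Rightarrow> 'a \<Rightarrow> 'a \<Rightarrow> 'e \<times> 'e \<Rightarrow> 'e" where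
  "mult_diff G p q = frechet_derivative
     (\<lambda>z. coord (mfd G) (p \<otimes>\<^bsub>G\<^esub> q)
        ((\<lambda>(g, h). g \<otimes>\<^bsub>G\<^esub> h) (inv_into (fst (pchart (mfd G) p) \<times> fst (pchart (mfd G) q))
           (map_prod (coord (mfd G) p) (coord (mfd G) q)) z)))
     (at (map_prod (coord (mfd G) p) (coord (mfd G) q) (p, q)))"

context
  fixes G :: "('a, 'e::real_inner) lie_grp"
  assumes G: "lie_group G"
begin

interpretation group G using lie_groupD(1)[OF G] .

private abbreviation (input) "M \<equiv> mfd G"
private abbreviation (input) "\<mu> \<equiv> \<lambda>(g, h). g \<otimes>\<^bsub>G\<^esub> h"

lemma pchart_prod:
  assumes "p \<in> carrier G" "q \<in> carrier G"
  shows "(fst (pchart M p) \<times> fst (pchart M q), map_prod (coord M p) (coord M q)) \<in> atlas (prod_mfd M M)"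
    "(p, q) \<in> fst (pchart M p) \<times> fst (pchart M q)"
proof -
  have "(fst (pchart M p), coord M p) \<in> atlas M" "(fst (pchart M q), coord M q) \<in> atlas M"
    "p \<in> fst (pchart M p)" "q \<in> fst (pchart M q)"
    using pchart_pair[OF lie_groupD(3)[OF G]] pchart(2)[OF lie_groupD(3)[OF G]] assms
    unfolding lie_groupD(4)[OF G] by blast+
  then show "(fst (pchart M p) \<times> fst (pchart M q), map_prod (coord M p) (coord M q)) \<in> atlas (prod_mfd M M)"
    "(p, q) \<in> fst (pchart M p) \<times> fst (pchart M q)"
    unfolding prod_mfd_def smooth_mfd.simps by blast+
qed

lemma mult_diff_has_derivative:
  assumes p: "p \<in> carrier G" and q: "q \<in> carrier G"
  shows "((\<lambda>z. coord M (p \<otimes>\<^bsub>G\<^esub> q) (\<mu> (inv_into (fst (pchart M p) \<times> fst (pchart M q))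
           (map_prod (coord M p) (coord M q)) z))) has_derivative mult_diff G p q)
     (at (map_prod (coord M p) (coord M q) (p, q)))"
proof -
  have pq: "p \<otimes>\<^bsub>G\<^esub> q \<in> topspace (mtop M)" using p q lie_groupD(4)[OF G] by simp
  then have "\<mu> (p, q) \<in> fst (pchart M (p \<otimes>\<^bsub>G\<^esub> q))" using pchart(2)[OF lie_groupD(3)[OF G] pq] by simp
  then show ?thesis
    unfolding mult_diff_def
    by (intro chart_map_has_derivative[OF charted_prod pchart_prod(1) lie_groupD(5) pchart_pair _ _]
        lie_groupD(3) G p q pq pchart_prod(2)[OF p q])
qed

lemma mult_diff_bounded_linear:
  assumes "p \<in> carrier G" "q \<in> carrier G"
  shows "bounded_linear (mult_diff G p q)"
  using mult_diff_has_derivative[OF assms] by (rule has_derivative_bounded_linear)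

text \<open>The product rule: the chain rule for the curve of pairs, read in the product of the two
  selected charts.\<close>

lemma has_velocity_mult:
  assumes \<gamma>: "curve_cont M \<gamma> t S" "has_velocity M \<gamma> v t S"
    and \<eta>: "curve_cont M \<eta> t S" "has_velocity M \<eta> w t S"
  shows "has_velocity M (\<lambda>s. \<gamma> s \<otimes>\<^bsub>G\<^esub> \<eta> s) (mult_diff G (\<gamma> t) (\<eta> t) (v, w)) t S"
proof -
  let ?p = "\<gamma> t" and ?q = "\<eta> t"
  have p: "?p \<in> carrier G" and q: "?q \<in> carrier G"
    using \<gamma> \<eta> lie_groupD(4)[OF G] by (auto simp: curve_cont_def)
  have pq: "?p \<otimes>\<^bsub>G\<^esub> ?q \<in> topspace (mtop M)" using p q lie_groupD(4)[OF G] by simp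
  have "((\<lambda>s. coord M (?p \<otimes>\<^bsub>G\<^esub> ?q) (\<mu> (\<gamma> s, \<eta> s))) has_vector_derivative
      frechet_derivative (\<lambda>z. coord M (?p \<otimes>\<^bsub>G\<^esub> ?q) (\<mu> (inv_into (fst (pchart M ?p) \<times> fst (pchart M ?q))
           (map_prod (coord M ?p) (coord M ?q)) z)))
        (at (map_prod (coord M ?p) (coord M ?q) (?p, ?q))) (v, w)) (at t within S)"
  proof (rule chart_velocity_map[where M = "prod_mfd M M" and N = M and f = \<mu>
        and U = "fst (pchart M ?p) \<times> fst (pchart M ?q)" and x = "map_prod (coord M ?p) (coord M ?q)"
        and V = "fst (pchart M (?p \<otimes>\<^bsub>G\<^esub> ?q))" and \<gamma> = "\<lambda>s. (\<gamma> s, \<eta> s)" and t = t])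
    show "charted (prod_mfd M M)" "charted M" "smooth_map (prod_mfd M M) M \<mu>"
      using charted_prod lie_groupD(3,5)[OF G] by blast+
    show "(fst (pchart M ?p) \<times> fst (pchart M ?q), map_prod (coord M ?p) (coord M ?q)) \<in> atlas (prod_mfd M M)"
      "(?p, ?q) \<in> fst (pchart M ?p) \<times> fst (pchart M ?q)"
      using pchart_prod[OF p q] by auto
    show "(fst (pchart M (?p \<otimes>\<^bsub>G\<^esub> ?q)), coord M (?p \<otimes>\<^bsub>G\<^esub> ?q)) \<in> atlas M"
      by (rule pchart_pair[OF lie_groupD(3)[OF G] pq])
    show "\<mu> (?p, ?q) \<in> fst (pchart M (?p \<otimes>\<^bsub>G\<^esub> ?q))"
      using pchart(2)[OF lie_groupD(3)[OF G] pq] by simp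
    show "curve_cont (prod_mfd M M) (\<lambda>s. (\<gamma> s, \<eta> s)) t S"
      by (rule curve_cont_Pair[OF \<gamma>(1) \<eta>(1)])
    show "((\<lambda>s. map_prod (coord M ?p) (coord M ?q) (\<gamma> s, \<eta> s)) has_vector_derivative (v, w)) (at t within S)"
      using has_vector_derivative_Pair \<gamma>(2) \<eta>(2) by (simp add: has_velocity_def)
  qed
  then show ?thesis by (simp add: has_velocity_def mult_diff_def)
qed

text \<open>Freezes the second coordinate of the product chart at that of \<open>q\<close>. This
  connects \<open>mult_diff\<close> with the differential in terms of which right invariance is
  defined.\<close>

lemma mult_diff_right_translation:
  assumes p: "p \<in> carrier G" and q: "q \<in> carrier G"
  shows "mult_diff G p q (v, 0) = mdiff M M (\<lambda>k. k \<otimes>\<^bsub>G\<^esub> q) p v"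
proof -
  let ?U = "fst (pchart M p)" and ?V = "fst (pchart M q)" and ?x = "coord M p" and ?y = "coord M q"
  let ?h = "\<lambda>z. coord M (p \<otimes>\<^bsub>G\<^esub> q) (\<mu> (inv_into (?U \<times> ?V) (map_prod ?x ?y) z))"
  have Mc: "charted M" using lie_groupD(3)[OF G] .
  have pT: "p \<in> topspace (mtop M)" using p lie_groupD(4)[OF G] by simp
  have pU: "p \<in> ?U" "q \<in> ?V" using pchart_prod(2)[OF p q] by auto
  have inj: "inj_on (map_prod ?x ?y) (?U \<times> ?V)"
    using chart_inj[OF charted_prod[OF Mc Mc] pchart_prod(1)[OF p q]] .
  note injx = chart_inj[OF Mc pchart_pair[OF Mc pT]]
  have "(?h has_derivative mult_diff G p q) (at (?x p, ?y q))"
    using mult_diff_has_derivative[OF p q] by simp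
  moreover have "((\<lambda>z. (z, ?y q)) has_derivative (\<lambda>v. (v, 0))) (at (?x p))"
    by (auto intro!: derivative_eq_intros)
  ultimately have "((\<lambda>z. ?h (z, ?y q)) has_derivative (\<lambda>v. mult_diff G p q (v, 0))) (at (?x p))"
    using has_derivative_compose[of "\<lambda>z. (z, ?y q)" "\<lambda>v. (v, 0)" "?x p" UNIV ?h "mult_diff G p q"] by simp
  moreover have "open (?x ` ?U)"
    using chart_image_open[OF Mc pchart_pair[OF Mc pT] chart_openin[OF Mc pchart_pair[OF Mc pT]]] by simp
  ultimately have "((\<lambda>z. coord M (p \<otimes>\<^bsub>G\<^esub> q) (inv_into ?U ?x z \<otimes>\<^bsub>G\<^esub> q)) has_derivative
      (\<lambda>v. mult_diff G p q (v, 0))) (at (?x p))"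
  proof (rule has_derivative_transform_within_open)
    show "?x p \<in> ?x ` ?U" using pU by simp
    fix z assume "z \<in> ?x ` ?U"
    then obtain k where k: "k \<in> ?U" "z = ?x k" by auto
    then have "inv_into (?U \<times> ?V) (map_prod ?x ?y) (z, ?y q) = (k, q)"
      using inv_into_f_f[OF inj, of "(k, q)"] pU by simp
    then show "?h (z, ?y q) = coord M (p \<otimes>\<^bsub>G\<^esub> q) (inv_into ?U ?x z \<otimes>\<^bsub>G\<^esub> q)"
      using k injx by simp
  qed
  then have "(\<lambda>v. mult_diff G p q (v, 0)) = mdiff M M (\<lambda>k. k \<otimes>\<^bsub>G\<^esub> q) p"
    unfolding mdiff_def uncoord_def coord_def[symmetric] by (rule frechet_derivative_at)
  then show ?thesis by (rule fun_cong)
qed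

lemma mult_diff_right_invariant_field:
  assumes "right_invariant_field G Y" "p \<in> carrier G" "q \<in> carrier G"
  shows "mult_diff G p q (Y p, 0) = Y (p \<otimes>\<^bsub>G\<^esub> q)"
  using assms mult_diff_right_translation by (simp add: right_invariant_field_def)

section \<open>Linear vector fields and their flows\<close>

context
  fixes X :: "'a \<Rightarrow> 'e" and \<phi> :: "real \<Rightarrow> 'a \<Rightarrow> 'a"
  assumes X: "linear_field_with_flow G X \<phi>"
begin

lemma flow_closed: "g \<in> carrier G \<Longrightarrow> \<phi> t g \<in> carrier G"
  and flow_mult: "g \<in> carrier G \<Longrightarrow> h \<in> carrier G \<Longrightarrow> \<phi> t (g \<otimes>\<^bsub>G\<^esub> h) = \<phi> t g \<otimes>\<^bsub>G\<^esub> \<phi> t h"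
  and flow_zero: "g \<in> carrier G \<Longrightarrow> \<phi> 0 g = g"
  and flow_velocity: "g \<in> carrier G \<Longrightarrow> has_velocity M (\<lambda>t. \<phi> t g) (X (\<phi> t g)) t UNIV"
  and flow_continuous: "g \<in> carrier G \<Longrightarrow> continuous_map euclideanreal (mtop M) (\<lambda>t. \<phi> t g)"
proof -
  have "\<phi> t \<in> hom G G"
    using X by (auto simp: linear_field_with_flow_def lie_automorphism_def iso_def)
  then show "g \<in> carrier G \<Longrightarrow> \<phi> t g \<in> carrier G"
    "g \<in> carrier G \<Longrightarrow> h \<in> carrier G \<Longrightarrow> \<phi> t (g \<otimes>\<^bsub>G\<^esub> h) = \<phi> t g \<otimes>\<^bsub>G\<^esub> \<phi> t h"
    by (auto simp: hom_def)
qed (use X in \<open>simp_all add: linear_field_with_flow_def\<close>)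

lemma flow_inverse:
  assumes "g \<in> carrier G" shows "\<phi> t (\<phi> (- t) g) = g"
proof -
  have "\<phi> (t + - t) g = \<phi> t (\<phi> (- t) g)"
    using X assms unfolding linear_field_with_flow_def by blast
  then show ?thesis using flow_zero[OF assms] by simp
qed

lemma flow_curve_cont:
  assumes "g \<in> carrier G" "t \<in> S" shows "curve_cont M (\<lambda>t. \<phi> t g) t S"
  using assms flow_continuous by (intro continuous_map_curve_cont) (simp_all add: continuous_map_from_subtopology)

text \<open>The infinitesimal form of \<open>flow_mult\<close>: both sides are the velocity at time
  zero of the curve \<open>\<phi> s p \<otimes> \<phi> s q\<close>, which is also the flow line
  through the product.\<close>

lemma mult_diff_linear_field:
  assumes p: "p \<in> carrier G" and q: "q \<in> carrier G"
  shows "mult_diff G p q (X p, X q) = X (p \<otimes>\<^bsub>G\<^esub> q)"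
proof -
  have "has_velocity M (\<lambda>s. \<phi> s p \<otimes>\<^bsub>G\<^esub> \<phi> s q) (mult_diff G (\<phi> 0 p) (\<phi> 0 q) (X (\<phi> 0 p), X (\<phi> 0 q))) 0 UNIV"
    by (intro has_velocity_mult flow_curve_cont flow_velocity p q) simp_all
  moreover have "(\<lambda>s. \<phi> s p \<otimes>\<^bsub>G\<^esub> \<phi> s q) = (\<lambda>s. \<phi> s (p \<otimes>\<^bsub>G\<^esub> q))"
    using flow_mult[OF p q] by simp
  ultimately show ?thesis
    using flow_velocity[of "p \<otimes>\<^bsub>G\<^esub> q" 0] p q flow_zero by (auto dest: has_velocity_unique)
qed

text \<open>The linear field \<open>X\<close> generates automorphisms and the control fields are right-invariant, so
  right multiplication by \<open>\<phi> t g\<close> maps trajectories to trajectories of the same control.\<close>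

lemma trajectory_translate:
  assumes Y: "\<And>i. i \<in> I \<Longrightarrow> right_invariant_field G (Y i)" and g: "g \<in> carrier G"
    and \<gamma>: "trajectory M (system_field X I Y u) T \<gamma>"
  shows "trajectory M (system_field X I Y u) T (\<lambda>t. \<gamma> t \<otimes>\<^bsub>G\<^esub> \<phi> t g)"
proof -
  have Mc: "charted M" using lie_groupD(3)[OF G] .
  have ac: "ac_curve M T \<gamma>" and v: "AE t in lborel. t \<in> {0..T} \<longrightarrow>
      has_velocity M \<gamma> (system_field X I Y u t (\<gamma> t)) t {0..T}"
    using \<gamma> by (simp_all add: trajectory_iff_ac_curve)
  have "ac_curve M T (\<lambda>t. \<phi> t g)"
    using X flow_continuous[OF g] flow_velocity[OF g]
    by (intro ac_curve_integral_curve[OF lie_groupD(2)[OF G], of X]) (simp_all add: linear_field_with_flow_def)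
  then have "ac_curve M T (\<lambda>t. \<mu> (\<gamma> t, \<phi> t g))"
    by (intro ac_curve_map[OF charted_prod[OF Mc Mc] Mc lie_groupD(5)[OF G]] ac_curve_Pair ac)
  moreover have "AE t in lborel. t \<in> {0..T} \<longrightarrow>
      has_velocity M (\<lambda>t. \<gamma> t \<otimes>\<^bsub>G\<^esub> \<phi> t g) (system_field X I Y u t (\<gamma> t \<otimes>\<^bsub>G\<^esub> \<phi> t g)) t {0..T}"
    using v
  proof eventually_elim
    case (elim t)
    show ?case
    proof
      assume t: "t \<in> {0..T}"
      let ?p = "\<gamma> t" and ?q = "\<phi> t g"
      have p: "?p \<in> carrier G" using ac_curve_subset(1)[OF ac t] lie_groupD(4)[OF G] by simp
      have q: "?q \<in> carrier G" using flow_closed[OF g] .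
      interpret D: bounded_linear "mult_diff G ?p ?q" by (rule mult_diff_bounded_linear[OF p q])
      have "has_velocity M (\<lambda>t. \<phi> t g) (X ?q) t {0..T}"
        using flow_velocity[OF g, of t] unfolding has_velocity_def
        by (rule has_vector_derivative_at_within)
      then have "has_velocity M (\<lambda>t. \<gamma> t \<otimes>\<^bsub>G\<^esub> \<phi> t g)
          (mult_diff G ?p ?q (system_field X I Y u t ?p, X ?q)) t {0..T}"
        using elim t by (intro has_velocity_mult ac_curve_subset(2)[OF ac t] flow_curve_cont g) simp_all
      moreover have "mult_diff G ?p ?q (system_field X I Y u t ?p, X ?q)
          = system_field X I Y u t (?p \<otimes>\<^bsub>G\<^esub> ?q)"
      proof -
        \<comment> \<open>The right factor moves by the drift \<open>X\<close> alone, so the control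
          fields enter with second component zero. Linearity then leaves one term for the linear
          field and one for each right-invariant field.\<close>
        have "(system_field X I Y u t ?p, X ?q) = (X ?p, X ?q) + (\<Sum>i\<in>I. u t i *\<^sub>R (Y i ?p, 0))"
          by (simp add: system_field_def prod_eq_iff fst_sum snd_sum)
        then have "mult_diff G ?p ?q (system_field X I Y u t ?p, X ?q)
            = mult_diff G ?p ?q (X ?p, X ?q) + (\<Sum>i\<in>I. u t i *\<^sub>R mult_diff G ?p ?q (Y i ?p, 0))"
          by (simp only: D.add D.sum D.scaleR)
        then show ?thesis
          using Y p q by (simp add: mult_diff_linear_field mult_diff_right_invariant_field system_field_def)
      qed
      ultimately show "has_velocity M (\<lambda>t. \<gamma> t \<otimes>\<^bsub>G\<^esub> \<phi> t g)
          (system_field X I Y u t (\<gamma> t \<otimes>\<^bsub>G\<^esub> \<phi> t g)) t {0..T}" by simp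
    qed
  qed
  ultimately show ?thesis by (simp add: trajectory_iff_ac_curve)
qed

end

end

section \<open>Connected Lie subgroups and their induced systems\<close>

context
  fixes G :: "('a, 'e::real_inner) lie_grp" and H :: "('a, 'f::real_inner) lie_grp" and \<hh>
  assumes G: "lie_group G" and H: "connected_lie_subgroup G \<hh> H"
begin

lemma lie_subgroupD:
  shows "lie_group H" "carrier H \<subseteq> carrier G" "\<one>\<^bsub>H\<^esub> = \<one>\<^bsub>G\<^esub>"
    "h \<in> carrier H \<Longrightarrow> k \<in> carrier H \<Longrightarrow> h \<otimes>\<^bsub>H\<^esub> k = h \<otimes>\<^bsub>G\<^esub> k"
    "smooth_map (mfd H) (mfd G) (\<lambda>h. h)"
    "h \<in> carrier H \<Longrightarrow> inj (mdiff (mfd H) (mfd G) (\<lambda>h. h) h)"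
    "range (mdiff (mfd H) (mfd G) (\<lambda>h. h) \<one>\<^bsub>H\<^esub>) = \<hh>"
proof -
  show HL: "lie_group H" and sub: "carrier H \<subseteq> carrier G"
    and mult: "h \<in> carrier H \<Longrightarrow> k \<in> carrier H \<Longrightarrow> h \<otimes>\<^bsub>H\<^esub> k = h \<otimes>\<^bsub>G\<^esub> k" for h k
    using H by (auto simp: connected_lie_subgroup_def connected_lie_group_def subgroup_def)
  interpret G: group G using lie_groupD(1)[OF G] .
  interpret H: group H using lie_groupD(1)[OF HL] .
  have "\<one>\<^bsub>H\<^esub> \<otimes>\<^bsub>G\<^esub> \<one>\<^bsub>H\<^esub> = \<one>\<^bsub>H\<^esub>" using mult[of "\<one>\<^bsub>H\<^esub>" "\<one>\<^bsub>H\<^esub>"] by simp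
  then show "\<one>\<^bsub>H\<^esub> = \<one>\<^bsub>G\<^esub>" using sub by (metis G.l_cancel_one H.one_closed subsetD)
qed (use H in \<open>auto simp: connected_lie_subgroup_def\<close>)

text \<open>Tangency to \<open>H\<close> is assumed only at the identity. Translating a curve in
  \<open>H\<close> through the identity by \<open>h\<close> spreads it to every \<open>h\<close>;
  injectivity of the differential of the inclusion then makes the definite description in
  \<open>restrict_field\<close> denote the vector found.\<close>

lemma mdiff_restrict_field:
  assumes Y: "right_invariant_field G Y" "Y \<one>\<^bsub>G\<^esub> \<in> \<hh>" and h: "h \<in> carrier H"
  shows "mdiff (mfd H) (mfd G) (\<lambda>h. h) h (restrict_field G H Y h) = Y h"
proof -
  let ?d = "mdiff (mfd H) (mfd G) (\<lambda>h. h)"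
  note HL = lie_subgroupD(1)
  interpret G: group G using lie_groupD(1)[OF G] .
  interpret H: group H using lie_groupD(1)[OF HL] .
  have Gc: "charted (mfd G)" and Hc: "charted (mfd H)" using lie_groupD(3) G HL by blast+
  have hG: "h \<in> carrier G" using h lie_subgroupD(2) by blast
  obtain w where w: "Y \<one>\<^bsub>G\<^esub> = ?d \<one>\<^bsub>H\<^esub> w" using Y(2) lie_subgroupD(7) by blast
  have oneH: "\<one>\<^bsub>H\<^esub> \<in> topspace (mtop (mfd H))" using lie_groupD(4)[OF HL] by simp
  obtain \<sigma> where \<sigma>0: "\<sigma> 0 = \<one>\<^bsub>H\<^esub>" and \<sigma>H: "\<And>s. \<sigma> s \<in> topspace (mtop (mfd H))"
    and \<sigma>: "curve_cont (mfd H) \<sigma> 0 UNIV" "has_velocity (mfd H) \<sigma> w 0 UNIV"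
    by (rule exists_curve_with_velocity[OF Hc oneH], rule that)
  have cH: "curve_cont (mfd H) (\<lambda>_. h) 0 UNIV" and cG: "curve_cont (mfd G) (\<lambda>_. h) 0 UNIV"
    using h hG lie_groupD(4)[OF HL] lie_groupD(4)[OF G] by (simp_all add: curve_cont_const)
  define v where "v = mult_diff H (\<sigma> 0) h (w, 0)"
  have "has_velocity (mfd H) (\<lambda>s. \<sigma> s \<otimes>\<^bsub>H\<^esub> h) v 0 UNIV"
    unfolding v_def by (rule has_velocity_mult[OF HL \<sigma> cH has_velocity_const])
  moreover have "curve_cont (mfd H) (\<lambda>s. \<sigma> s \<otimes>\<^bsub>H\<^esub> h) 0 UNIV"
    using curve_cont_map[OF _ curve_cont_Pair[OF \<sigma>(1) cH], of "mfd H" "\<lambda>(g, h). g \<otimes>\<^bsub>H\<^esub> h"]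
      lie_groupD(5)[OF HL] by (simp add: smooth_map_def)
  ultimately have "has_velocity (mfd G) (\<lambda>s. \<sigma> s \<otimes>\<^bsub>H\<^esub> h) (?d (\<sigma> 0 \<otimes>\<^bsub>H\<^esub> h) v) 0 UNIV"
    by (intro has_velocity_map[OF Hc Gc lie_subgroupD(5)])
  then have 1: "has_velocity (mfd G) (\<lambda>s. \<sigma> s \<otimes>\<^bsub>G\<^esub> h) (?d h v) 0 UNIV"
    using \<sigma>0 \<sigma>H h lie_subgroupD(4) lie_groupD(4)[OF HL] by simp
  \<comment> \<open>Second computation of the same velocity: include the curve into \<open>G\<close>
    first and translate there, where right invariance of \<open>Y\<close> identifies the
    result.\<close>
  have "has_velocity (mfd G) \<sigma> (Y \<one>\<^bsub>G\<^esub>) 0 UNIV"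
    using has_velocity_map[OF Hc Gc lie_subgroupD(5) \<sigma>] by (simp add: w \<sigma>0)
  moreover have "curve_cont (mfd G) \<sigma> 0 UNIV"
    using lie_subgroupD(5) by (intro curve_cont_map[OF _ \<sigma>(1), where f = "\<lambda>h. h"]) (simp add: smooth_map_def)
  ultimately have "has_velocity (mfd G) (\<lambda>s. \<sigma> s \<otimes>\<^bsub>G\<^esub> h) (mult_diff G (\<sigma> 0) h (Y \<one>\<^bsub>G\<^esub>, 0)) 0 UNIV"
    by (intro has_velocity_mult[OF G] cG has_velocity_const)
  then have "has_velocity (mfd G) (\<lambda>s. \<sigma> s \<otimes>\<^bsub>G\<^esub> h) (Y h) 0 UNIV"
    using mult_diff_right_invariant_field[OF G Y(1) G.one_closed hG] hG
    by (simp add: \<sigma>0 lie_subgroupD(3))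
  with 1 have v: "?d h v = Y h" by (rule has_velocity_unique)
  then have "(THE v. ?d h v = Y h) = v"
    using lie_subgroupD(6)[OF h] by (auto simp: inj_def)
  with v show ?thesis by (simp add: restrict_field_def)
qed

text \<open>Both fields have the same flow line through \<open>h\<close>, so its velocities in
  \<open>H\<close> and in \<open>G\<close> correspond under the inclusion.\<close>

lemma mdiff_linear_field:
  assumes X: "linear_field_with_flow G X \<phi>" and XH: "linear_field_with_flow H XH \<phi>"
    and h: "h \<in> carrier H"
  shows "mdiff (mfd H) (mfd G) (\<lambda>h. h) h (XH h) = X h"
proof -
  note HL = lie_subgroupD(1)
  have hG: "h \<in> carrier G" using h lie_subgroupD(2) by blast
  have "has_velocity (mfd G) (\<lambda>t. \<phi> t h) (mdiff (mfd H) (mfd G) (\<lambda>h. h) (\<phi> 0 h) (XH (\<phi> 0 h))) 0 UNIV"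
    using flow_curve_cont[OF HL XH h] flow_velocity[OF HL XH h]
    by (intro has_velocity_map lie_groupD(3) G HL lie_subgroupD(5)) simp_all
  then show ?thesis
    using flow_velocity[OF G X hG, of 0] flow_zero[OF HL XH h] by (auto dest: has_velocity_unique)
qed

text \<open>The inclusion relates the induced field to the ambient one summand by summand.
  \<open>H\<close> may carry a topology finer than that induced from \<open>G\<close>; smoothness of
  the inclusion suffices for this direction.\<close>

lemma trajectory_subgroup:
  assumes X: "linear_field_with_flow G X \<phi>" and XH: "linear_field_with_flow H XH \<phi>"
    and Y: "\<And>i. i \<in> I \<Longrightarrow> right_invariant_field G (Y i) \<and> Y i \<one>\<^bsub>G\<^esub> \<in> \<hh>"
    and \<gamma>: "trajectory (mfd H) (system_field XH I (\<lambda>i. restrict_field G H (Y i)) u) T \<gamma>"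
  shows "trajectory (mfd G) (system_field X I Y u) T \<gamma>"
proof (rule trajectory_map[OF _ _ lie_subgroupD(5) \<gamma>])
  show Hc: "charted (mfd H)" and Gc: "charted (mfd G)"
    using lie_groupD(3) G lie_subgroupD(1) by blast+
  fix t p assume pT: "p \<in> topspace (mtop (mfd H))"
  then have p: "p \<in> carrier H" using lie_groupD(4)[OF lie_subgroupD(1)] by simp
  interpret d: bounded_linear "mdiff (mfd H) (mfd G) (\<lambda>h. h) p"
    by (rule mdiff_bounded_linear[OF Hc Gc lie_subgroupD(5) pT])
  show "mdiff (mfd H) (mfd G) (\<lambda>h. h) p (system_field XH I (\<lambda>i. restrict_field G H (Y i)) u t p)
      = system_field X I Y u t p"
    using Y p by (simp add: system_field_def d.add d.sum d.scaleR mdiff_linear_field[OF X XH]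
        mdiff_restrict_field)
qed

end

section \<open>Reachability\<close>

definition reachable ::
  "('a, 'e::real_inner) smooth_mfd \<Rightarrow> ('a \<Rightarrow> 'e) \<Rightarrow> 'i set \<Rightarrow> ('i \<Rightarrow> 'a \<Rightarrow> 'e) \<Rightarrow>
   (real \<Rightarrow> 'i \<Rightarrow> real) set \<Rightarrow> 'a \<Rightarrow> 'a \<Rightarrow> bool" where
  "reachable M X I Y \<U> g h \<longleftrightarrow>
     (\<exists>t\<ge>0. \<exists>u\<in>\<U>. \<exists>\<gamma>. trajectory M (system_field X I Y u) t \<gamma> \<and> \<gamma> 0 = g \<and> \<gamma> t = h)"

lemma reachable_trans:
  assumes \<U>: "control_class I \<U>" and "reachable M X I Y \<U> g h" "reachable M X I Y \<U> h k"
  shows "reachable M X I Y \<U> g k"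
proof -
  obtain T u \<gamma> T' u' \<gamma>' where T: "0 \<le> T" "0 \<le> T'" and u: "u \<in> \<U>" "u' \<in> \<U>"
    and \<gamma>: "trajectory M (system_field X I Y u) T \<gamma>" "\<gamma> 0 = g" "\<gamma> T = h"
    and \<gamma>': "trajectory M (system_field X I Y u') T' \<gamma>'" "\<gamma>' 0 = h" "\<gamma>' T' = k"
    using assms(2,3) unfolding reachable_def by blast
  let ?u = "\<lambda>t. if t < T then u t else u' (t - T)"
  let ?\<gamma> = "\<lambda>t. if t \<le> T then \<gamma> t else \<gamma>' (t - T)"
  have "(\<lambda>t. if t < T then system_field X I Y u t else system_field X I Y u' (t - T)) = system_field X I Y ?u"
    by (auto simp: system_field_def fun_eq_iff)
  then have "trajectory M (system_field X I Y ?u) (T + T') ?\<gamma>"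
    using trajectory_concat[OF \<gamma>(1) \<gamma>'(1) T] \<gamma>(3) \<gamma>'(2) by simp
  moreover have "?u \<in> \<U>"
    using \<U> u T unfolding control_class_def by blast
  \<comment> \<open>If \<open>T' = 0\<close>, the final time still belongs to the first piece, and
    the endpoint is right because the pieces meet.\<close>
  moreover have "?\<gamma> 0 = g" "?\<gamma> (T + T') = k"
    using \<gamma>(2,3) \<gamma>'(2,3) T by (cases "T' = 0"; simp)+
  moreover have "0 \<le> T + T'" using T by simp
  ultimately show ?thesis unfolding reachable_def by blast
qed

lemma system_field_join_controls_left:
  assumes "finite I" "finite J"
  shows "system_field X (I <+> J) (case_sum Y Z) (join_controls u (\<lambda>t j. 0)) = system_field X I Y u"
  using assms by (auto simp: system_field_def join_controls_def fun_eq_iff sum.Plus)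

lemma system_field_join_controls_right:
  assumes "finite I" "finite J"
  shows "system_field X (I <+> J) (case_sum Y Z) (join_controls (\<lambda>t i. 0) v) = system_field X J Z v"
  using assms by (auto simp: system_field_def join_controls_def fun_eq_iff sum.Plus)

text \<open>The order of quantifiers matters: time and control are chosen for \<open>g\<close> and
  \<open>h\<close> inside \<open>H\<close>, and \<open>k\<close> merely translates the resulting
  trajectory. Hence \<open>k\<close> may later be chosen in terms of \<open>t\<close>. The premise
  \<open>emb\<close> abstracts from which block of controls of the full system belongs to
  \<open>H\<close>.\<close>

lemma reachable_along_subgroup:
  assumes G: "lie_group G" and H: "connected_lie_subgroup G \<hh> H"
    and X: "linear_field_with_flow G X \<phi>" and XH: "linear_field_with_flow H XH \<phi>"
    and Y: "\<And>i. i \<in> I \<Longrightarrow> right_invariant_field G (Y i) \<and> Y i \<one>\<^bsub>G\<^esub> \<in> \<hh>"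
    and ctrl: "controllable (mfd H) XH I (\<lambda>i. restrict_field G H (Y i)) V"
    and emb: "\<And>u. u \<in> V \<Longrightarrow> \<exists>w\<in>\<U>. system_field X J Z w = system_field X I Y u"
    and g: "g \<in> carrier H" and h: "h \<in> carrier H"
  shows "\<exists>t. \<forall>k\<in>carrier G. reachable (mfd G) X J Z \<U> (g \<otimes>\<^bsub>G\<^esub> k) (h \<otimes>\<^bsub>G\<^esub> \<phi> t k)"
proof -
  obtain t u \<gamma> where t: "t \<ge> 0" and u: "u \<in> V" and ends: "\<gamma> 0 = g" "\<gamma> t = h"
    and "trajectory (mfd H) (system_field XH I (\<lambda>i. restrict_field G H (Y i)) u) t \<gamma>"
    using ctrl g h lie_groupD(4)[OF lie_subgroupD(1)[OF G H]] unfolding controllable_def by blast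
  then have \<gamma>: "trajectory (mfd G) (system_field X I Y u) t \<gamma>"
    by (intro trajectory_subgroup[OF G H X XH Y])
  obtain w where w: "w \<in> \<U>" "system_field X J Z w = system_field X I Y u"
    using emb[OF u] by blast
  show ?thesis
  proof (intro exI[of _ t] ballI)
    fix k assume k: "k \<in> carrier G"
    have "trajectory (mfd G) (system_field X J Z w) t (\<lambda>s. \<gamma> s \<otimes>\<^bsub>G\<^esub> \<phi> s k)"
      unfolding w(2) using Y k \<gamma> by (intro trajectory_translate[OF G X]) blast+
    moreover have "\<gamma> 0 \<otimes>\<^bsub>G\<^esub> \<phi> 0 k = g \<otimes>\<^bsub>G\<^esub> k" "\<gamma> t \<otimes>\<^bsub>G\<^esub> \<phi> t k = h \<otimes>\<^bsub>G\<^esub> \<phi> t k"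
      using ends flow_zero[OF G X k] by simp_all
    ultimately show "reachable (mfd G) X J Z \<U> (g \<otimes>\<^bsub>G\<^esub> k) (h \<otimes>\<^bsub>G\<^esub> \<phi> t k)"
      unfolding reachable_def using t w(1)
      by (intro exI[of _ t] conjI bexI[of _ w] exI[of _ "\<lambda>s. \<gamma> s \<otimes>\<^bsub>G\<^esub> \<phi> s k"])
  qed
qed

theorem theorem3p1:
  fixes G :: "('a, 'e::real_inner) lie_grp"
    and Gp :: "('a, 'p::real_inner) lie_grp"
    and Gm :: "('a, 'm::real_inner) lie_grp"
    and X :: "'a \<Rightarrow> 'e" and Xp :: "'a \<Rightarrow> 'p" and Xm :: "'a \<Rightarrow> 'm"
    and \<phi> :: "real \<Rightarrow> 'a \<Rightarrow> 'a"
    and m\<^sub>p m\<^sub>m :: nat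
    and Yp Ym :: "nat \<Rightarrow> 'a \<Rightarrow> 'e"
    and Up Um :: "(real \<Rightarrow> nat \<Rightarrow> real) set"
    and U :: "(real \<Rightarrow> nat + nat \<Rightarrow> real) set"
  assumes "connected_lie_group G" and "solvable G"
    and "linear_field_with_flow G X \<phi>" and "hyperbolic G X"
    and "direct_sum_decomposition (lie_plus G X) (lie_minus G X)"
    and "connected_lie_subgroup G (lie_plus G X) Gp"
    and "connected_lie_subgroup G (lie_minus G X) Gm"
    and "carrier G = carrier Gp <#>\<^bsub>G\<^esub> carrier Gm"
    and "carrier G = carrier Gm <#>\<^bsub>G\<^esub> carrier Gp"
    and "linear_field_with_flow Gp Xp \<phi>"
    and "linear_field_with_flow Gm Xm \<phi>"
    and "\<And>\<alpha>. \<alpha> < m\<^sub>p \<Longrightarrow> right_invariant_field G (Yp \<alpha>) \<and> Yp \<alpha> \<one>\<^bsub>G\<^esub> \<in> lie_plus G X"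
    and "\<And>\<beta>. \<beta> < m\<^sub>m \<Longrightarrow> right_invariant_field G (Ym \<beta>) \<and> Ym \<beta> \<one>\<^bsub>G\<^esub> \<in> lie_minus G X"
    and "control_class {..<m\<^sub>p} Up" and "control_class {..<m\<^sub>m} Um"
    and "control_class ({..<m\<^sub>p} <+> {..<m\<^sub>m}) U"
    and "\<And>u v. u \<in> Up \<Longrightarrow> v \<in> Um \<Longrightarrow>
           join_controls u (\<lambda>t \<beta>. 0) \<in> U \<and> join_controls (\<lambda>t \<alpha>. 0) v \<in> U \<and> join_controls u v \<in> U"
    and "controllable (mfd Gp) Xp {..<m\<^sub>p} (\<lambda>\<alpha>. restrict_field G Gp (Yp \<alpha>)) Up"
    and "controllable (mfd Gm) Xm {..<m\<^sub>m} (\<lambda>\<beta>. restrict_field G Gm (Ym \<beta>)) Um"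
  shows "controllable (mfd G) X ({..<m\<^sub>p} <+> {..<m\<^sub>m}) (case_sum Yp Ym) U"
proof -
  let ?I = "{..<m\<^sub>p}" and ?J = "{..<m\<^sub>m}"
  let ?R = "reachable (mfd G) X (?I <+> ?J) (case_sum Yp Ym) U"
  have G: "lie_group G" using assms(1) by (simp add: connected_lie_group_def)
  note X = assms(3) and Gp = assms(6) and Gm = assms(7) and Xp = assms(10) and Xm = assms(11)
  interpret group G using lie_groupD(1)[OF G] .
  \<comment> \<open>Independent splitting is stated for pairs of controls, so the zero control
    serves as partner when one subsystem is steered alone.\<close>
  have zero: "(\<lambda>t \<alpha>. 0) \<in> Up" "(\<lambda>t \<beta>. 0) \<in> Um"
    using assms(14,15) by (simp_all add: control_class_def)
  have embp: "\<exists>w\<in>U. system_field X (?I <+> ?J) (case_sum Yp Ym) w = system_field X ?I Yp u" if "u \<in> Up" for u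
    using assms(17)[OF that zero(2)] by (blast intro: system_field_join_controls_left)
  have embm: "\<exists>w\<in>U. system_field X (?I <+> ?J) (case_sum Yp Ym) w = system_field X ?J Ym v" if "v \<in> Um" for v
    using assms(17)[OF zero(1) that] by (blast intro: system_field_join_controls_right)
  have Yp: "right_invariant_field G (Yp \<alpha>) \<and> Yp \<alpha> \<one>\<^bsub>G\<^esub> \<in> lie_plus G X" if "\<alpha> \<in> ?I" for \<alpha>
    using assms(12) that by simp
  have Ym: "right_invariant_field G (Ym \<beta>) \<and> Ym \<beta> \<one>\<^bsub>G\<^esub> \<in> lie_minus G X" if "\<beta> \<in> ?J" for \<beta>
    using assms(13) that by simp
  have p: "\<exists>t. \<forall>k\<in>carrier G. ?R (g \<otimes>\<^bsub>G\<^esub> k) (h \<otimes>\<^bsub>G\<^esub> \<phi> t k)"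
    if "g \<in> carrier Gp" "h \<in> carrier Gp" for g h
    by (rule reachable_along_subgroup[OF G Gp X Xp Yp assms(18) embp that])
  have m: "\<exists>t. \<forall>k\<in>carrier G. ?R (g \<otimes>\<^bsub>G\<^esub> k) (h \<otimes>\<^bsub>G\<^esub> \<phi> t k)"
    if "g \<in> carrier Gm" "h \<in> carrier Gm" for g h
    by (rule reachable_along_subgroup[OF G Gm X Xm Ym assms(19) embm that])
  have subp: "carrier Gp \<subseteq> carrier G" and subm: "carrier Gm \<subseteq> carrier G" and one: "\<one>\<^bsub>G\<^esub> \<in> carrier Gm"
    using lie_subgroupD(2,3)[OF G Gp] lie_subgroupD(2,3)[OF G Gm]
      group.is_monoid[OF lie_groupD(1)[OF lie_subgroupD(1)[OF G Gm]]] monoid.one_closed by fastforce+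
  \<comment> \<open>Keeps the passive factor trivial during the middle phase, whatever its
    duration.\<close>
  have flow_one: "\<phi> t \<one>\<^bsub>G\<^esub> = \<one>\<^bsub>G\<^esub>" for t
    using flow_mult[OF G X one_closed one_closed, of t] flow_closed[OF G X one_closed, of t] by simp
  have "?R g h" if gh: "g \<in> carrier G" "h \<in> carrier G" for g h
  proof -
    \<comment> \<open>The steered factor has to stand on the left and the passive one on the right,
      hence the decomposition with \<open>Gm\<close> first.\<close>
    obtain b a where g: "g = b \<otimes>\<^bsub>G\<^esub> a" and b: "b \<in> carrier Gm" and a: "a \<in> carrier Gp"
      using gh(1) unfolding assms(9) set_mult_def by blast
    obtain b' a' where h: "h = b' \<otimes>\<^bsub>G\<^esub> a'" and b': "b' \<in> carrier Gm" and a': "a' \<in> carrier Gp"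
      using gh(2) unfolding assms(9) set_mult_def by blast
    have aG: "a \<in> carrier G" and a'G: "a' \<in> carrier G" using a a' subp by auto
    obtain t where "\<forall>k\<in>carrier G. ?R (b \<otimes>\<^bsub>G\<^esub> k) (\<one>\<^bsub>G\<^esub> \<otimes>\<^bsub>G\<^esub> \<phi> t k)"
      using m[OF b one] by blast
    from bspec[OF this aG] have 1: "?R g (\<phi> t a)"
      using aG flow_closed[OF G X aG] by (simp add: g)
    \<comment> \<open>The last phase is fixed before the middle one, since the target of the middle
      phase depends on \<open>s\<close>.\<close>
    obtain s where s: "\<forall>k\<in>carrier G. ?R (\<one>\<^bsub>G\<^esub> \<otimes>\<^bsub>G\<^esub> k) (b' \<otimes>\<^bsub>G\<^esub> \<phi> s k)"
      using m[OF one b'] by blast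
    \<comment> \<open>Invariance of \<open>Gp\<close> under the flow comes from \<phi> being the
      flow of a linear field on \<open>Gp\<close> itself.\<close>
    have c: "\<phi> (- s) a' \<in> carrier Gp" and d: "\<phi> t a \<in> carrier Gp"
      using flow_closed[OF lie_subgroupD(1)[OF G Gp] Xp] a a' by simp_all
    have 3: "?R (\<phi> (- s) a') h"
      using bspec[OF s flow_closed[OF G X a'G, of "- s"]] flow_closed[OF G X a'G, of "- s"]
        flow_inverse[OF G X a'G, of s] by (simp add: h)
    obtain r where "\<forall>k\<in>carrier G. ?R (\<phi> t a \<otimes>\<^bsub>G\<^esub> k) (\<phi> (- s) a' \<otimes>\<^bsub>G\<^esub> \<phi> r k)"
      using p[OF d c] by blast
    from bspec[OF this one_closed] have 2: "?R (\<phi> t a) (\<phi> (- s) a')"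
      using flow_closed[OF G X aG] flow_closed[OF G X a'G] by (simp add: flow_one)
    show ?thesis
      by (rule reachable_trans[OF assms(16) reachable_trans[OF assms(16) 1 2] 3])
  qed
  then show ?thesis
    unfolding controllable_def lie_groupD(4)[OF G] reachable_def by blast
qed

end
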